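(* Let $F$ be a non-discrete locally compact non-archimedean field of characteristic $\neq 2$, with residue field of characteristic $p$ and cardinality $q$. Let $R$ be an integral domain with $p\in R^\times$ and with a fixed square root $q^{1/2}$ of $q$ in $R$, and let $\chi:F\to R^\times$ be a non-trivial smooth character. Let $X$ be a finite-dimensional $F$-vector space, with a fixed $R$-valued Haar measure $dx$. Let $f$ be a non-degenerate quadratic form on $X$ associated to the symmetric isomorphism $\rho:X\to X^*$, let $\gamma(f)\in R^\times$ be its Weil factor, put $\varphi=\chi\circ f$, and let $\mathbf s=\mathbf d_0'(\rho^{-1})\mathbf t_0(f)\mathbf d_0'(-\rho^{-1})\mathbf t_0(f)$ and $\mathbf s'=\mathbf t_0(-f)\mathbf d_0'(\rho^{-1})$ in $\mathrm{Aut}(\mathcal S(X))$. 1. For every $\Phi\in\mathcal S(X)$ and for every $x\in X$ we have $$\mathbf s\Phi(x)=|\rho|\,\mathscr F(\Phi*\varphi)(\rho(x))\quad\text{and}\quad\mathbf s'\Phi(x)=|\rho|^{1/2}\,\mathscr F\Phi(\rho(x))\,\varphi(x)^{-1}.$$ 2. For every $\Phi\in\mathcal S(X)$ and for every $x^*\in X^*$ we have $$\mathscr F(\Phi*\varphi)(x^* )=\gamma(f)|\rho|^{-1/2}\,\mathscr F\Phi(x^* )\,\varphi(\rho^{-1}x^* )^{-1}.$$ 3. There exists a sufficiently large compact open subgroup $K_0$ of $X$ such that for every compact open subgroup $K$ of $X$ containing $K_0$ and for every $x^*\in X^*$, the integral $\int_K\varphi(x)\langle x,x^*\rangle dx$ does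 not depend on $K$. Moreover we have $$\int_K\varphi(x)\langle x,x^*\rangle dx=\gamma(f)|\rho|^{-1/2}\varphi(\rho^{-1}x^* )^{-1},$$ and one denotes $\mathscr F\varphi(x^* )=\int_K\varphi(x)\langle x,x^*\rangle dx$. 4. If $K$ is a sufficiently large compact open subgroup of $X$, we have $$\gamma(f)=|\rho|^{1/2}\int_K\chi(f(x))dx.$$
   Context: A smooth character of $F$ is a group homomorphism $F\to R^\times$ with open kernel. $X^*=\mathrm{Hom}_F(X,F)$, $\langle x,x^*\rangle=\chi(x^*(x))$, and $X^{**}$ is identified with $X$. $\mathcal S(X)$ is the $R$-module of locally constant compactly supported functions $X\to R$, and $\mathrm{Aut}(\mathcal S(X))$ its group of $R$-linear automorphisms. A Haar measure $dx$ on $X$ with values in $R$ is fixed. For a compact open subgroup $K$ of $X$ put $K_*=\{x^*\in X^*:\langle k,x^*\rangle=1\ \forall k\in K\}$, a compact open subgroup of $X^*$. If $K'$ is such that $\mathrm{vol}(K',dx)=1$, the dual measure $dx^*$ of $dx$ is the Haar measure on $X^*$ with $\mathrm{vol}(K'_*,dx^* )=1$. For an isomorphism $\nu:G\to H$ of $F$-vector spaces with fixed Haar measures (here $G,H\in\{X,X^*\}$ with the measures $dx,dx^*$), the module $|\nu|$ is the constant such that $\int_H\Phi(y)dy=|\nu|\int_G\Phi(\nu(x))dx$ for $\Phi\in\mathcal S(H)$; it is an integer power of $q$ in $R$, and if $|\nu|=q^a$ one puts $|\nu|^{1/2}=(q^{1/2})^a\in R$. Fourier transform: $\mathscr F\Phi(x^*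 )=\int_X\Phi(x)\langle x,x^*\rangle dx$ for $\Phi\in\mathcal S(X)$. Convolution: $(\Phi*\varphi)(x)=\int_X\Phi(x')\varphi(x-x')dx'$, which lies in $\mathcal S(X)$ for $\Phi\in\mathcal S(X)$ and $\varphi=\chi\circ f$ as in the claim. For an isomorphism $\beta:X^*\to X$, $\mathbf d_0'(\beta)\in\mathrm{Aut}(\mathcal S(X))$ is $\mathbf d_0'(\beta)\Phi=|\beta|^{-1/2}(\mathscr F\Phi\circ\beta^{-1})$. For a quadratic form $f$ on $X$, $\mathbf t_0(f)\Phi=(\chi\circ f)\cdot\Phi$. A quadratic form on $X$ is a continuous map $f:X\to F$ with $f(ux)=u^2f(x)$ for $u\in F$ and with $(x,y)\mapsto f(x+y)-f(x)-f(y)$ $F$-bilinear. To $f$ is associated the symmetric homomorphism $\rho:X\to X^*$, $\rho(x)(y)=f(x+y)-f(x)-f(y)$; $f$ is non-degenerate if $\rho$ is an isomorphism. For non-degenerate $f$, the operators $\mathbf s$ and $\mathbf s'$ of the claim differ by a scalar in $R^\times$, and the Weil factor $\gamma(f)\in R^\times$ is the element such that $\mathbf s=\gamma(f)\mathbf s'$.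
   Formalization: Claim 3 fails with one K_0 for all x^*: for X nonzero the integral over K is 0 when ρ^{-1}x^* is outside a large K. Proved instead: K_0 may depend on x^*; moreover one K_0 works for all K containing K_0 and all x^* with ρ^{-1}x^* in K. *)

theory Defs
  imports "HOL-Analysis.Analysis" "HOL-Library.Function_Algebras"
begin

text \<open>
  The field F is a type with a topology, and \<open>v\<close> is an auxiliary ultrametric absolute
  value inducing that topology.  Its valuation ring and maximal ideal depend only on the topology.
\<close>

locale nonarch_local_field =
  fixes v :: "'f::{field,topological_space} \<Rightarrow> real"
  assumes v_nonneg: "0 \<le> v x"
    and v_eq_0_iff: "v x = 0 \<longleftrightarrow> x = 0"
    and v_mult: "v (x * y) = v x * v y"
    and v_ultrametric: "v (x + y) \<le> max (v x) (v y)"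
    and open_iff_v: "open U \<longleftrightarrow> (\<forall>x\<in>U. \<exists>e>0. \<forall>y. v (y - x) < e \<longrightarrow> y \<in> U)"
    and locally_compact: "locally_compact_space (euclidean :: 'f topology)"
    and non_discrete: "\<exists>S :: 'f set. \<not> open S"

definition valuation_ring :: "('f::field \<Rightarrow> real) \<Rightarrow> 'f set" where
  "valuation_ring v = {x. v x \<le> 1}"

definition maximal_ideal :: "('f::field \<Rightarrow> real) \<Rightarrow> 'f set" where
  "maximal_ideal v = {x. v x < 1}"

definition residue_field :: "('f::field \<Rightarrow> real) \<Rightarrow> 'f set set" where
  "residue_field v =
     valuation_ring v // {(x, y) \<in> valuation_ring v \<times> valuation_ring v. x - y \<in> maximal_ideal v}"

text \<open>The characteristic of the residue field, as in \<^const>\<open>semiring_char\<close>.\<close>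

definition residue_char :: "('f::field \<Rightarrow> real) \<Rightarrow> nat" where
  "residue_char v = Gcd {n. of_nat n \<in> maximal_ideal v}"

text \<open>Inverses and integer powers of units of R; only meaningful for units.\<close>

definition unit_inv :: "'r::idom \<Rightarrow> 'r" where
  "unit_inv u = (THE w. u * w = 1)"

definition unit_powi :: "'r::idom \<Rightarrow> int \<Rightarrow> 'r" where
  "unit_powi u a = (if 0 \<le> a then u ^ nat a else unit_inv u ^ nat (- a))"

definition smooth_character :: "('f::{field,topological_space} \<Rightarrow> 'r::idom) \<Rightarrow> bool" where
  "smooth_character chi \<longleftrightarrow>
     (\<forall>x. chi x dvd 1) \<and> (\<forall>x y. chi (x + y) = chi x * chi y) \<and> open {x. chi x = 1}"

text \<open>
  The dual space, a subset of the function type 'x \<Rightarrow> 'f (with pointwise addition).  It is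
  topologised as a subspace of the product topology.  The space X carries the initial topology for
  its linear functionals; in finite dimension both are the product topologies with respect to any
  basis.
\<close>

definition dual :: "('f::field \<Rightarrow> 'x::ab_group_add \<Rightarrow> 'x) \<Rightarrow> ('x \<Rightarrow> 'f) set" where
  "dual smul = {l. Vector_Spaces.linear smul (*) l}"

definition space_top ::
    "('f::{field,topological_space} \<Rightarrow> 'x::ab_group_add \<Rightarrow> 'x) \<Rightarrow> 'x topology" where
  "space_top smul = topology_generated_by {l -` U |l U. l \<in> dual smul \<and> open U}"

definition dual_top ::
    "('f::{field,topological_space} \<Rightarrow> 'x::ab_group_add \<Rightarrow> 'x) \<Rightarrow> ('x \<Rightarrow> 'f) topology" where
  "dual_top smul = top_of_set (dual smul)"

definition compact_open_subgroup :: "'g::ab_group_add topology \<Rightarrow> 'g set \<Rightarrow> bool" where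
  "compact_open_subgroup T K \<longleftrightarrow>
     openin T K \<and> compactin T K \<and> 0 \<in> K \<and> (\<forall>x\<in>K. \<forall>y\<in>K. x - y \<in> K)"

text \<open>
  Functions on a space are total functions on its ambient type vanishing off the underlying set
  of the space.
\<close>

definition schwartz :: "'g topology \<Rightarrow> ('g \<Rightarrow> 'r::idom) set" where
  "schwartz T = {\<Phi>.
     (\<forall>x. x \<notin> topspace T \<longrightarrow> \<Phi> x = 0) \<and>
     (\<forall>x\<in>topspace T. \<exists>U. openin T U \<and> x \<in> U \<and> (\<forall>y\<in>U. \<Phi> y = \<Phi> x)) \<and>
     compactin T (T closure_of {x. \<Phi> x \<noteq> 0})}"

text \<open>
  An R-valued Haar measure is a non-zero translation invariant linear form on the locally constant
  compactly supported functions.  Its values at other functions are irrelevant.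
\<close>

definition haar_measure ::
    "'g::ab_group_add topology \<Rightarrow> (('g \<Rightarrow> 'r::idom) \<Rightarrow> 'r) \<Rightarrow> bool" where
  "haar_measure T \<mu> \<longleftrightarrow>
     (\<forall>\<Phi>\<in>schwartz T. \<forall>\<Psi>\<in>schwartz T. \<mu> (\<lambda>x. \<Phi> x + \<Psi> x) = \<mu> \<Phi> + \<mu> \<Psi>) \<and>
     (\<forall>c. \<forall>\<Phi>\<in>schwartz T. \<mu> (\<lambda>x. c * \<Phi> x) = c * \<mu> \<Phi>) \<and>
     (\<forall>g\<in>topspace T. \<forall>\<Phi>\<in>schwartz T. \<mu> (\<lambda>x. \<Phi> (g + x)) = \<mu> \<Phi>) \<and>
     (\<exists>\<Phi>\<in>schwartz T. \<mu> \<Phi> \<noteq> 0)"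

definition integral_over :: "(('g \<Rightarrow> 'r::idom) \<Rightarrow> 'r) \<Rightarrow> 'g set \<Rightarrow> ('g \<Rightarrow> 'r) \<Rightarrow> 'r" where
  "integral_over \<mu> K h = \<mu> (\<lambda>x. if x \<in> K then h x else 0)"

definition vol :: "(('g \<Rightarrow> 'r::idom) \<Rightarrow> 'r) \<Rightarrow> 'g set \<Rightarrow> 'r" where
  "vol \<mu> K = integral_over \<mu> K (\<lambda>_. 1)"

definition annihilator ::
    "('f::field \<Rightarrow> 'x::ab_group_add \<Rightarrow> 'x) \<Rightarrow> ('f \<Rightarrow> 'r::idom) \<Rightarrow> 'x set \<Rightarrow> ('x \<Rightarrow> 'f) set" where
  "annihilator smul chi K = {l \<in> dual smul. \<forall>k\<in>K. chi (l k) = 1}"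

definition dual_measure ::
    "('f::{field,topological_space} \<Rightarrow> 'x::ab_group_add \<Rightarrow> 'x) \<Rightarrow> ('f \<Rightarrow> 'r::idom) \<Rightarrow>
     (('x \<Rightarrow> 'r) \<Rightarrow> 'r) \<Rightarrow> ((('x \<Rightarrow> 'f) \<Rightarrow> 'r) \<Rightarrow> 'r) \<Rightarrow> bool" where
  "dual_measure smul chi \<mu> \<mu>' \<longleftrightarrow>
     haar_measure (dual_top smul) \<mu>' \<and>
     (\<exists>K. compact_open_subgroup (space_top smul) K \<and> vol \<mu> K = 1 \<and>
          vol \<mu>' (annihilator smul chi K) = 1)"

text \<open>The module of an isomorphism from G to H.\<close>

definition iso_module ::
    "'g topology \<Rightarrow> (('g \<Rightarrow> 'r::idom) \<Rightarrow> 'r) \<Rightarrow> 'h topology \<Rightarrow> (('h \<Rightarrow> 'r) \<Rightarrow> 'r) \<Rightarrow>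
     ('g \<Rightarrow> 'h) \<Rightarrow> 'r" where
  "iso_module G \<mu> H \<mu>' \<nu> =
     (THE c. \<forall>\<Phi>\<in>schwartz H. \<mu>' \<Phi> = c * integral_over \<mu> (topspace G) (\<lambda>x. \<Phi> (\<nu> x)))"

definition fourier ::
    "('f::field \<Rightarrow> 'x::ab_group_add \<Rightarrow> 'x) \<Rightarrow> ('f \<Rightarrow> 'r::idom) \<Rightarrow> (('x \<Rightarrow> 'r) \<Rightarrow> 'r) \<Rightarrow>
     ('x \<Rightarrow> 'r) \<Rightarrow> ('x \<Rightarrow> 'f) \<Rightarrow> 'r" where
  "fourier smul chi \<mu> \<Phi> = (\<lambda>l. if l \<in> dual smul then \<mu> (\<lambda>x. \<Phi> x * chi (l x)) else 0)"

definition convolution ::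
    "(('x::ab_group_add \<Rightarrow> 'r::idom) \<Rightarrow> 'r) \<Rightarrow> ('x \<Rightarrow> 'r) \<Rightarrow> ('x \<Rightarrow> 'r) \<Rightarrow> 'x \<Rightarrow> 'r" where
  "convolution \<mu> \<Phi> \<phi> = (\<lambda>x. \<mu> (\<lambda>x'. \<Phi> x' * \<phi> (x - x')))"

definition polar :: "('x::ab_group_add \<Rightarrow> 'f::field) \<Rightarrow> 'x \<Rightarrow> 'x \<Rightarrow> 'f" where
  "polar f x = (\<lambda>y. f (x + y) - f x - f y)"

definition quadratic_form ::
    "('f::{field,topological_space} \<Rightarrow> 'x::ab_group_add \<Rightarrow> 'x) \<Rightarrow> ('x \<Rightarrow> 'f) \<Rightarrow> bool" where
  "quadratic_form smul f \<longleftrightarrow>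
     continuous_map (space_top smul) euclidean f \<and>
     (\<forall>u x. f (smul u x) = u\<^sup>2 * f x) \<and>
     (\<forall>x. Vector_Spaces.linear smul (*) (\<lambda>y. polar f x y)) \<and>
     (\<forall>y. Vector_Spaces.linear smul (*) (\<lambda>x. polar f x y))"

text \<open>For a quadratic form, the map \<open>polar f\<close> from X to its dual is automatically linear.\<close>

definition nondegenerate ::
    "('f::field \<Rightarrow> 'x::ab_group_add \<Rightarrow> 'x) \<Rightarrow> ('x \<Rightarrow> 'f) \<Rightarrow> bool" where
  "nondegenerate smul f \<longleftrightarrow> bij_betw (polar f) UNIV (dual smul)"

text \<open>
  Here \<open>b\<close> is an exponent with \<open>\<bar>\<beta>\<bar> = q^b\<close>, and \<open>r\<close> is the chosen
  square root of q, so that \<open>\<bar>\<beta>\<bar>^(-1/2) = r^(-b)\<close>.  The exponent is an argument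
  because q may have finite order in the unit group of R, in which case the element
  \<open>\<bar>\<beta>\<bar>\<close> of R does not determine \<open>r^b\<close>.
\<close>

definition d0' ::
    "('f::field \<Rightarrow> 'x::ab_group_add \<Rightarrow> 'x) \<Rightarrow> ('f \<Rightarrow> 'r::idom) \<Rightarrow> (('x \<Rightarrow> 'r) \<Rightarrow> 'r) \<Rightarrow> 'r \<Rightarrow>
     int \<Rightarrow> (('x \<Rightarrow> 'f) \<Rightarrow> 'x) \<Rightarrow> ('x \<Rightarrow> 'r) \<Rightarrow> 'x \<Rightarrow> 'r" where
  "d0' smul chi \<mu> r b \<beta> \<Phi> =
     (\<lambda>x. unit_powi r (- b) * fourier smul chi \<mu> \<Phi> (inv_into (dual smul) \<beta> x))"

definition t0 ::
    "('f \<Rightarrow> 'r::idom) \<Rightarrow> ('x \<Rightarrow> 'f) \<Rightarrow> ('x \<Rightarrow> 'r) \<Rightarrow> 'x \<Rightarrow> 'r" where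
  "t0 chi f \<Phi> = (\<lambda>x. chi (f x) * \<Phi> x)"

text \<open>
  In the following, \<open>a\<close> is an exponent with \<open>\<bar>\<rho>\<bar> = q^a\<close> for
  \<open>\<rho> = polar f\<close>; then both \<open>\<rho>\<^sup>-\<^sup>1\<close> and its negative have module \<open>q^(-a)\<close>.
\<close>

definition weil_s ::
    "('f::field \<Rightarrow> 'x::ab_group_add \<Rightarrow> 'x) \<Rightarrow> ('f \<Rightarrow> 'r::idom) \<Rightarrow> (('x \<Rightarrow> 'r) \<Rightarrow> 'r) \<Rightarrow> 'r \<Rightarrow>
     int \<Rightarrow> ('x \<Rightarrow> 'f) \<Rightarrow> ('x \<Rightarrow> 'r) \<Rightarrow> 'x \<Rightarrow> 'r" where
  "weil_s smul chi \<mu> r a f =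
     d0' smul chi \<mu> r (- a) (inv (polar f)) \<circ> t0 chi f \<circ>
     d0' smul chi \<mu> r (- a) (\<lambda>l. - inv (polar f) l) \<circ> t0 chi f"

definition weil_s' ::
    "('f::field \<Rightarrow> 'x::ab_group_add \<Rightarrow> 'x) \<Rightarrow> ('f \<Rightarrow> 'r::idom) \<Rightarrow> (('x \<Rightarrow> 'r) \<Rightarrow> 'r) \<Rightarrow> 'r \<Rightarrow>
     int \<Rightarrow> ('x \<Rightarrow> 'f) \<Rightarrow> ('x \<Rightarrow> 'r) \<Rightarrow> 'x \<Rightarrow> 'r" where
  "weil_s' smul chi \<mu> r a f =
     t0 chi (\<lambda>x. - f x) \<circ> d0' smul chi \<mu> r (- a) (inv (polar f))"

definition weil_factor ::
    "('f::{field,topological_space} \<Rightarrow> 'x::ab_group_add \<Rightarrow> 'x) \<Rightarrow> ('f \<Rightarrow> 'r::idom) \<Rightarrow>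
     (('x \<Rightarrow> 'r) \<Rightarrow> 'r) \<Rightarrow> 'r \<Rightarrow> int \<Rightarrow> ('x \<Rightarrow> 'f) \<Rightarrow> 'r" where
  "weil_factor smul chi \<mu> r a f =
     (THE g. g dvd 1 \<and> (\<forall>\<Phi>\<in>schwartz (space_top smul).
        weil_s smul chi \<mu> r a f \<Phi> = (\<lambda>x. g * weil_s' smul chi \<mu> r a f \<Phi> x)))"

end

theory Submission
  imports Defs
begin

text \<open>
  Write \<open>B(x, y) = \<chi>(\<rho>(x)(y))\<close>, so that \<open>\<phi>(x + y) = \<phi>(x) \<phi>(y) B(x, y)\<close>.  If \<open>\<phi>\<close> is trivial on a
  compact open subgroup \<open>H\<close>, averaging over translates by \<open>H\<close> shows that \<open>\<phi>\<close> contributes to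
  \<open>\<integral>\<^sub>K \<phi>\<close> only on the orthogonal of \<open>H\<close>, which is bounded by non-degeneracy.  Hence
  \<open>G = \<integral>\<^sub>K \<phi>\<close> is the same for all large \<open>K\<close>.  Completing the square gives
  \<open>\<integral>\<^sub>K \<phi>(x) B(y, x) dx = G \<phi>(y)\<^sup>-\<^sup>1\<close>, and exchanging integrals (finite sums over cosets)
  \<open>\<F>(\<Phi> * \<phi>)(\<rho> y) = G \<F>\<Phi>(\<rho> y) \<phi>(y)\<^sup>-\<^sup>1\<close>.  The same exchange gives
  \<open>G \<cdot> \<integral>\<^sub>K \<phi>\<^sup>-\<^sup>1 = vol(K) vol(K\<^sup>\<bottom>)\<close>, so \<open>G\<close> is a unit, and comparing \<open>s\<close> with \<open>s'\<close> yields
  \<open>\<gamma>(f) = r\<^sup>a G\<close>.  Volumes are units because some compact open subgroup has volume 1 and every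
  other one can be contracted into it; \<open>q\<close> is a unit because the residue field is a finite group
  killed by \<open>p\<close>.
\<close>

section \<open>Subgroups of finite index\<close>

text \<open>Values in \<open>R\<close> offer no positivity, limits or absolute values, so integrals
  are rewritten as a volume times a finite sum over coset representatives, and cancellation rests on
  volumes being units of the domain \<open>R\<close>. To keep topology out of these computations, X
  is replaced by a family of subgroups \<open>L \<epsilon>\<close>, later the balls of radius
  \<open>\<epsilon>\<close> in coordinates: compact open subgroups become subgroups squeezed between
  two balls, and Schwartz functions become step functions. The dual space disappears too:
  \<open>\<rho>\<close> identifies it with X, and only the bicharacter \<open>B\<close> remains. The
  obstacle is that \<open>\<phi>\<close> has no compact support and is locally constant only with a
  radius that shrinks as its argument grows. Uniformity is therefore always stated relative to a
  lattice, and the integral of \<open>\<phi>\<close> against \<open>B(y, x)\<close> is controlled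
  only over lattices containing \<open>y\<close>, because completing the square translates by
  \<open>y\<close>. Invertibility of \<open>q\<close> matters because the normalising factors are
  integer powers of its square root \<open>r\<close>.\<close>

definition add_subgroup :: "'a::ab_group_add set \<Rightarrow> bool" where
  "add_subgroup H \<longleftrightarrow> 0 \<in> H \<and> (\<forall>x\<in>H. \<forall>y\<in>H. x - y \<in> H)"

lemma add_subgroupI:
  "0 \<in> H \<Longrightarrow> (\<And>x y. x \<in> H \<Longrightarrow> y \<in> H \<Longrightarrow> x - y \<in> H) \<Longrightarrow> add_subgroup H"
  by (auto simp: add_subgroup_def)

lemma add_subgroup_zero: "add_subgroup H \<Longrightarrow> 0 \<in> H"
  by (auto simp: add_subgroup_def)

lemma add_subgroup_diff: "add_subgroup H \<Longrightarrow> x \<in> H \<Longrightarrow> y \<in> H \<Longrightarrow> x - y \<in> H"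
  by (auto simp: add_subgroup_def)

lemma add_subgroup_minus: "add_subgroup H \<Longrightarrow> x \<in> H \<Longrightarrow> - x \<in> H"
  using add_subgroup_diff[of H 0 x] add_subgroup_zero[of H] by simp

lemma add_subgroup_add: "add_subgroup H \<Longrightarrow> x \<in> H \<Longrightarrow> y \<in> H \<Longrightarrow> x + y \<in> H"
  using add_subgroup_diff[of H x "- y"] add_subgroup_minus[of H y] by simp

lemma add_subgroup_add_iff: "add_subgroup H \<Longrightarrow> y \<in> H \<Longrightarrow> x + y \<in> H \<longleftrightarrow> x \<in> H"
  using add_subgroup_add[of H x y] add_subgroup_diff[of H "x + y" y] by auto

lemma add_subgroup_diff_iff: "add_subgroup H \<Longrightarrow> y \<in> H \<Longrightarrow> x - y \<in> H \<longleftrightarrow> x \<in> H"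
  using add_subgroup_add_iff[of H "- y" x] add_subgroup_minus[of H y] by auto

lemma add_subgroup_minus_iff: "add_subgroup H \<Longrightarrow> - x \<in> H \<longleftrightarrow> x \<in> H"
  using add_subgroup_minus[of H x] add_subgroup_minus[of H "- x"] by auto

text \<open>Representatives stand in for the quotient group: the index of \<open>H\<close> in
  \<open>K\<close> is \<open>card C\<close>, and an integral over \<open>K\<close> becomes a sum
  over \<open>C\<close>.\<close>

definition transversal :: "'a::ab_group_add set \<Rightarrow> 'a set \<Rightarrow> 'a set \<Rightarrow> bool" where
  "transversal K H C \<longleftrightarrow> finite C \<and> C \<subseteq> K \<and> (\<forall>x\<in>K. \<exists>!c. c \<in> C \<and> x - c \<in> H)"

text \<open>The element of \<open>D\<close> chosen for \<open>x\<close> depends only on the coset of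
  \<open>x\<close>, so the chosen elements hit each coset once. \<open>D\<close> may reach outside
  \<open>K\<close>, but a chosen element differs from a point of \<open>K\<close> by an element of
  \<open>H\<close>, hence lies in \<open>K\<close>.\<close>

lemma transversal_exists:
  assumes H: "add_subgroup H" and K: "add_subgroup K" and HK: "H \<subseteq> K"
    and D: "finite D" "\<And>x. x \<in> K \<Longrightarrow> \<exists>d\<in>D. x - d \<in> H"
  obtains C where "transversal K H C"
proof -
  define g where "g x = (SOME d. d \<in> D \<and> x - d \<in> H)" for x
  have g: "g x \<in> D \<and> x - g x \<in> H" if "x \<in> K" for x
    unfolding g_def by (rule someI_ex) (use D(2)[OF that] in blast)
  have gK: "g x \<in> K" if "x \<in> K" for x
  proof -
    have "x - (x - g x) \<in> K"
      using g[OF that] HK that K by (blast intro: add_subgroup_diff)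
    then show ?thesis by simp
  qed
  have geq: "g x = g y" if "x - y \<in> H" for x y
  proof -
    have "x - d \<in> H \<longleftrightarrow> y - d \<in> H" for d
      using add_subgroup_add_iff[OF H that, of "y - d"] by (simp add: algebra_simps)
    then show ?thesis by (simp add: g_def)
  qed
  have "transversal K H (g ` K)"
    unfolding transversal_def
  proof (intro conjI ballI)
    show "finite (g ` K)" by (rule finite_subset[OF _ D(1)]) (use g in blast)
    show "g ` K \<subseteq> K" using gK by blast
    fix x assume x: "x \<in> K"
    show "\<exists>!c. c \<in> g ` K \<and> x - c \<in> H"
    proof (rule ex1I[of _ "g x"])
      show "g x \<in> g ` K \<and> x - g x \<in> H" using g x by blast
      fix c assume c: "c \<in> g ` K \<and> x - c \<in> H"
      then obtain y where y: "y \<in> K" "c = g y" by blast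
      have "y - c - (x - c) \<in> H"
        using g[OF y(1)] y(2) c H by (blast intro: add_subgroup_diff)
      then show "c = g x" using y(2) geq[of y x] by simp
    qed
  qed
  then show ?thesis by (rule that)
qed

text \<open>An injective homomorphism preserves indices; applied to a contraction of X when volumes
  are compared.\<close>

lemma transversal_image:
  assumes C: "transversal K H C" and \<sigma>: "inj \<sigma>" "\<And>x y. \<sigma> (x - y) = \<sigma> x - \<sigma> y"
  shows "transversal (\<sigma> ` K) (\<sigma> ` H) (\<sigma> ` C)"
  unfolding transversal_def
proof (intro conjI ballI)
  show "finite (\<sigma> ` C)" "\<sigma> ` C \<subseteq> \<sigma> ` K" using C by (auto simp: transversal_def)
  fix y assume "y \<in> \<sigma> ` K"
  then obtain x where x: "x \<in> K" "y = \<sigma> x" by blast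
  obtain c where c: "c \<in> C" "x - c \<in> H" "\<And>c'. c' \<in> C \<Longrightarrow> x - c' \<in> H \<Longrightarrow> c' = c"
    using C x(1) unfolding transversal_def by metis
  have mem: "\<sigma> x - \<sigma> c' \<in> \<sigma> ` H \<longleftrightarrow> x - c' \<in> H" for c'
    using inj_image_mem_iff[OF \<sigma>(1), of "x - c'" H] by (simp add: \<sigma>(2))
  show "\<exists>!c. c \<in> \<sigma> ` C \<and> y - c \<in> \<sigma> ` H"
  proof (rule ex1I[of _ "\<sigma> c"])
    show "\<sigma> c \<in> \<sigma> ` C \<and> y - \<sigma> c \<in> \<sigma> ` H" using c(1,2) x(2) mem by blast
    show "d = \<sigma> c" if "d \<in> \<sigma> ` C \<and> y - d \<in> \<sigma> ` H" for d
      using that c(3) x(2) mem by blast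
  qed
qed

text \<open>Connects counting by representatives with the set of classes in
  \<open>residue_field\<close>.\<close>

lemma card_quotient_eq_transversal:
  assumes H: "add_subgroup H" and C: "transversal K H C"
  shows "card (K // {(x, y) \<in> K \<times> K. x - y \<in> H}) = card C"
proof -
  let ?R = "{(x, y) \<in> K \<times> K. x - y \<in> H}"
  have CK: "C \<subseteq> K" and ex: "\<And>x. x \<in> K \<Longrightarrow> \<exists>!c. c \<in> C \<and> x - c \<in> H"
    using C by (auto simp: transversal_def)
  have inj: "inj_on (\<lambda>c. ?R `` {c}) C"
  proof (rule inj_onI)
    fix c d assume cd: "c \<in> C" "d \<in> C" "?R `` {c} = ?R `` {d}"
    have "d \<in> ?R `` {d}" using cd(2) CK add_subgroup_zero[OF H] by auto
    then have "c - d \<in> H" using cd(3) by auto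
    moreover have "c - c \<in> H" using add_subgroup_zero[OF H] by simp
    ultimately show "c = d" using ex[of c] cd(1,2) CK by blast
  qed
  have img: "(\<lambda>c. ?R `` {c}) ` C = K // ?R"
  proof (intro equalityI subsetI)
    fix Q assume "Q \<in> (\<lambda>c. ?R `` {c}) ` C"
    then obtain c where "c \<in> K" "Q = ?R `` {c}" using CK by blast
    then show "Q \<in> K // ?R" by (simp only: quotientI)
  next
    fix Q assume "Q \<in> K // ?R"
    then obtain x where x: "x \<in> K" "Q = ?R `` {x}" by (rule quotientE)
    obtain c where c: "c \<in> C" "x - c \<in> H" using ex[OF x(1)] by blast
    have "x - y \<in> H \<longleftrightarrow> c - y \<in> H" for y
      using add_subgroup_add_iff[OF H c(2), of "c - y"] by simp
    then have "?R `` {x} = ?R `` {c}" using x(1) c(1) CK by auto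
    then show "Q \<in> (\<lambda>c. ?R `` {c}) ` C" using x(2) c(1) by blast
  qed
  show ?thesis using card_image[OF inj] unfolding img .
qed

section \<open>Quotients killed by a number that is invertible in \<open>R\<close>\<close>

lemma add_subgroup_of_nat_mult:
  fixes x :: "'a::comm_ring_1"
  assumes "add_subgroup H" "x \<in> H"
  shows "of_nat n * x \<in> H"
  by (induction n) (use assms in \<open>auto simp: add_subgroup_zero distrib_right intro: add_subgroup_add\<close>)

text \<open>Adjoining \<open>c\<close> multiplies the index over \<open>M\<close> by the order of
  \<open>c\<close> modulo \<open>H\<close>, which divides \<open>p\<close>. Minimality of
  \<open>H'\<close>, the last conclusion, keeps repeated adjunction inside a given
  \<open>K\<close>.\<close>

lemma index_unit_adjoin:
  fixes M :: "'a::comm_ring_1 set" and c :: 'a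
  assumes M: "add_subgroup M" and H: "add_subgroup H" and MH: "M \<subseteq> H" and C: "transversal H M C"
    and p: "p > 0" "of_nat p * c \<in> H"
  obtains H' C' d where "add_subgroup H'" "H \<subseteq> H'" "c \<in> H'" "transversal H' M C'"
    "card C' = card C * d" "d dvd p"
    "\<And>K. add_subgroup K \<Longrightarrow> H \<subseteq> K \<Longrightarrow> c \<in> K \<Longrightarrow> H' \<subseteq> K"
proof -
  \<comment> \<open>Natural multiples already form a group: modulo \<open>H\<close>, the negative of
    \<open>c\<close> is \<open>p - 1\<close> times \<open>c\<close>.\<close>
  define H' where "H' = {h + of_nat i * c | h i. h \<in> H}"
  have H': "add_subgroup H'"
  proof (rule add_subgroupI)
    show "0 \<in> H'" unfolding H'_def using add_subgroup_zero[OF H] by (force intro: exI[of _ 0])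
    fix x y assume "x \<in> H'" "y \<in> H'"
    then obtain h i h' j where *: "h \<in> H" "x = h + of_nat i * c" "h' \<in> H" "y = h' + of_nat j * c"
      unfolding H'_def by blast
    obtain n where n: "p = Suc n" using p(1) by (cases p) auto
    have "x - y = (h - h' - of_nat j * (of_nat p * c)) + of_nat (i + j * n) * c"
      using * by (simp add: algebra_simps n)
    moreover have "h - h' - of_nat j * (of_nat p * c) \<in> H"
      using * add_subgroup_diff[OF H] add_subgroup_of_nat_mult[OF H p(2)] by blast
    ultimately show "x - y \<in> H'" unfolding H'_def by blast
  qed
  have HH': "H \<subseteq> H'" unfolding H'_def by (force intro: exI[of _ 0])
  have cH': "c \<in> H'" unfolding H'_def using add_subgroup_zero[OF H] by (force intro: exI[of _ 0] exI[of _ 1])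
  \<comment> \<open>This is the order of \<open>c\<close> modulo \<open>H\<close>; the new
    representatives will be the x + i c with x in \<open>C\<close> and i < d.\<close>
  define d where "d = (LEAST d. d > 0 \<and> of_nat d * c \<in> H)"
  have d: "d > 0" "of_nat d * c \<in> H"
    using LeastI[of "\<lambda>d. d > 0 \<and> of_nat d * c \<in> H" p] p by (auto simp: d_def)
  have d_min: "e = 0" if "e < d" "of_nat e * c \<in> H" for e
    using not_less_Least[of e "\<lambda>d. d > 0 \<and> of_nat d * c \<in> H"] that by (auto simp: d_def)
  have split: "of_nat i * c = of_nat (i div d) * (of_nat d * c) + of_nat (i mod d) * c" for i
    unfolding mult.assoc[symmetric] of_nat_mult[symmetric] distrib_right[symmetric] of_nat_add[symmetric]
    by simp
  have "d dvd p"
  proof -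
    have "of_nat (p mod d) * c = of_nat p * c - of_nat (p div d) * (of_nat d * c)"
      using split[of p] by (simp add: algebra_simps)
    then have "of_nat (p mod d) * c \<in> H"
      using add_subgroup_diff[OF H p(2) add_subgroup_of_nat_mult[OF H d(2)]] by simp
    then have "p mod d = 0" using d_min d(1) by simp
    then show ?thesis by blast
  qed
  have CH: "C \<subseteq> H" and finC: "finite C" and ex: "\<And>x. x \<in> H \<Longrightarrow> \<exists>!c. c \<in> C \<and> x - c \<in> M"
    using C by (auto simp: transversal_def)
  \<comment> \<open>A congruence modulo \<open>M\<close> is also one modulo \<open>H\<close>, so (j
    - i) c lies in \<open>H\<close> with j - i < d; minimality of \<open>d\<close> gives i = j, and
    then \<open>C\<close> separates x from y.\<close>
  have le: "x = y \<and> i = j"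
    if "x \<in> C" "y \<in> C" "i < d" "j < d" "i \<le> j" "(x + of_nat i * c) - (y + of_nat j * c) \<in> M" for x y i j
  proof -
    have "of_nat (j - i) * c = (x - y) - ((x + of_nat i * c) - (y + of_nat j * c))"
      using that(5) by (simp add: of_nat_diff algebra_simps)
    also have "\<dots> \<in> H" using that CH MH add_subgroup_diff[OF H] by blast
    finally have "j - i = 0" using d_min[of "j - i"] that(4) by simp
    then have ij: "i = j" using that(5) by simp
    then have "x - y \<in> M" using that(6) by simp
    moreover have "x - x \<in> M" using add_subgroup_zero[OF M] by simp
    ultimately have "x = y" using ex[of x] that(1,2) CH by blast
    then show ?thesis using ij by simp
  qed
  have uniq: "x = y \<and> i = j"
    if "x \<in> C" "y \<in> C" "i < d" "j < d" "(x + of_nat i * c) - (y + of_nat j * c) \<in> M" for x y i j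
  proof (cases "i \<le> j")
    case True
    then show ?thesis using le that by blast
  next
    case False
    have "(y + of_nat j * c) - (x + of_nat i * c) \<in> M"
      using add_subgroup_minus[OF M that(5)] by simp
    then show ?thesis using le[of y x j i] that False by auto
  qed
  define g where "g = (\<lambda>(x, i). x + of_nat i * c)"
  have inj: "inj_on g (C \<times> {..<d})"
  proof (rule inj_onI)
    fix a b assume ab: "a \<in> C \<times> {..<d}" "b \<in> C \<times> {..<d}" "g a = g b"
    have "(fst a + of_nat (snd a) * c) - (fst b + of_nat (snd b) * c) \<in> M"
      using ab(3) add_subgroup_zero[OF M] by (simp add: g_def case_prod_beta)
    then show "a = b" using uniq[of "fst a" "fst b" "snd a" "snd b"] ab(1,2) by (auto simp: prod_eq_iff)
  qed
  have "transversal H' M (g ` (C \<times> {..<d}))"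
    unfolding transversal_def
  proof (intro conjI ballI)
    show "finite (g ` (C \<times> {..<d}))" using finC by simp
    show "g ` (C \<times> {..<d}) \<subseteq> H'" using CH by (auto simp: g_def H'_def)
    fix y assume "y \<in> H'"
    then obtain h i where y: "h \<in> H" "y = h + of_nat i * c" unfolding H'_def by blast
    have "h + of_nat (i div d) * (of_nat d * c) \<in> H"
      using y(1) add_subgroup_add[OF H] add_subgroup_of_nat_mult[OF H d(2)] by blast
    then obtain x where x: "x \<in> C" "h + of_nat (i div d) * (of_nat d * c) - x \<in> M" using ex by blast
    have yx: "y - g (x, i mod d) \<in> M"
      using x(2) split[of i] by (simp add: y(2) g_def algebra_simps)
    show "\<exists>!a. a \<in> g ` (C \<times> {..<d}) \<and> y - a \<in> M"
    proof (rule ex1I[of _ "g (x, i mod d)"])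
      show "g (x, i mod d) \<in> g ` (C \<times> {..<d}) \<and> y - g (x, i mod d) \<in> M"
        using x(1) d(1) yx by simp
      fix a assume a: "a \<in> g ` (C \<times> {..<d}) \<and> y - a \<in> M"
      then obtain x' i' where a': "x' \<in> C" "i' < d" "a = g (x', i')" by auto
      have "(y - g (x, i mod d)) - (y - a) \<in> M" using add_subgroup_diff[OF M yx] a by blast
      then have "(x' + of_nat i' * c) - (x + of_nat (i mod d) * c) \<in> M" by (simp add: a'(3) g_def algebra_simps)
      then have "x' = x \<and> i' = i mod d" by (rule uniq[OF a'(1) x(1) a'(2), rotated]) (simp add: d(1))
      then show "a = g (x, i mod d)" using a'(3) by simp
    qed
  qed
  moreover have "card (g ` (C \<times> {..<d})) = card C * d"
    using card_image[OF inj] by (simp add: card_cartesian_product)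
  moreover have "H' \<subseteq> K" if "add_subgroup K" "H \<subseteq> K" "c \<in> K" for K
    unfolding H'_def using that add_subgroup_add[OF that(1)] add_subgroup_of_nat_mult[OF that(1)] by blast
  ultimately show ?thesis using that H' HH' cH' \<open>d dvd p\<close> by blast
qed

text \<open>\<open>K\<close> is reached from \<open>M\<close> by adjoining finitely many elements
  one at a time; each step contributes a factor dividing \<open>p\<close>, and a divisor of a unit
  is a unit.\<close>

lemma index_unit_exponent:
  fixes M K :: "'a::comm_ring_1 set"
  assumes M: "add_subgroup M" and K: "add_subgroup K" and MK: "M \<subseteq> K"
    and p: "p > 0" "\<And>x. x \<in> K \<Longrightarrow> of_nat p * x \<in> M" "of_nat p dvd (1::'r::idom)"
    and D: "finite D" "\<And>x. x \<in> K \<Longrightarrow> \<exists>d\<in>D. x - d \<in> M"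
  obtains C where "transversal K M C" "of_nat (card C) dvd (1::'r)"
proof -
  have "\<exists>H C. add_subgroup H \<and> M \<subseteq> H \<and> S \<subseteq> H \<and> H \<subseteq> K \<and> transversal H M C \<and> of_nat (card C) dvd (1::'r)"
    if "finite S" "S \<subseteq> K" for S
    using that
  proof (induction S rule: finite_induct)
    case empty
    have "transversal M M {0}" using M by (auto simp: transversal_def add_subgroup_zero)
    then show ?case using M MK by (intro exI[of _ M] exI[of _ "{0}"]) simp
  next
    case (insert c S)
    then obtain H C where *: "add_subgroup H" "M \<subseteq> H" "S \<subseteq> H" "H \<subseteq> K" "transversal H M C"
      "of_nat (card C) dvd (1::'r)" by blast
    have cK: "c \<in> K" and pc: "of_nat p * c \<in> H" using insert.prems p(2) *(2) by auto
    obtain H' C' d where **: "add_subgroup H'" "H \<subseteq> H'" "c \<in> H'" "transversal H' M C'"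
      "card C' = card C * d" "d dvd p" "H' \<subseteq> K"
      using index_unit_adjoin[OF M *(1,2,5) p(1) pc] K *(4) cK by metis
    have "of_nat d dvd (1::'r)" using **(6) p(3) by (metis dvd_trans of_nat_dvd_iff of_nat_mult dvd_def)
    then have "of_nat (card C') dvd (1::'r)" using *(6) mult_dvd_mono[of _ "1::'r" _ 1] by (simp add: **(5))
    then show ?case using ** * by (intro exI[of _ H'] exI[of _ C']) auto
  qed
  \<comment> \<open>Elements of \<open>D\<close> that represent cosets within \<open>K\<close> lie
    in \<open>K\<close> themselves, so adjoining \<open>D \<inter> K\<close> exhausts
    \<open>K\<close>.\<close>
  from this[of "D \<inter> K"] obtain H C where *: "add_subgroup H" "M \<subseteq> H" "D \<inter> K \<subseteq> H" "H \<subseteq> K"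
    "transversal H M C" "of_nat (card C) dvd (1::'r)" using D(1) by blast
  have "K \<subseteq> H"
  proof
    fix x assume x: "x \<in> K"
    then obtain d where d: "d \<in> D" "x - d \<in> M" using D(2) by blast
    have "x - (x - d) \<in> K" using add_subgroup_diff[OF K x] d(2) MK by blast
    then have "d \<in> H" using d(1) *(3) by auto
    then have "x - d + d \<in> H" using d(2) *(2) add_subgroup_add[OF *(1)] by blast
    then show "x \<in> H" by simp
  qed
  then have "H = K" using *(4) by blast
  then show ?thesis using that *(5,6) by blast
qed

section \<open>Invariant functionals on a filtered group\<close>

text \<open>The \<open>L \<epsilon>\<close> model a neighbourhood basis of 0 made of compact open
  subgroups; \<open>L_finite_index\<close> is the form in which compactness enters.\<close>

locale filtered_group =
  fixes L :: "real \<Rightarrow> 'x::ab_group_add set"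
  assumes subgroup_L: "\<epsilon> > 0 \<Longrightarrow> add_subgroup (L \<epsilon>)"
    and L_mono: "0 < \<delta> \<Longrightarrow> \<delta> \<le> \<epsilon> \<Longrightarrow> L \<delta> \<subseteq> L \<epsilon>"
    and L_exhaust: "\<exists>\<epsilon>>0. x \<in> L \<epsilon>"
    and L_finite_index: "0 < \<delta> \<Longrightarrow> 0 < \<epsilon> \<Longrightarrow> \<exists>D. finite D \<and> (\<forall>x\<in>L \<epsilon>. \<exists>d\<in>D. x - d \<in> L \<delta>)"
begin

text \<open>In the application these are exactly the compact open subgroups of X.\<close>

definition lattice :: "'x set \<Rightarrow> bool" where
  "lattice K \<longleftrightarrow> add_subgroup K \<and> (\<exists>\<delta>>0. L \<delta> \<subseteq> K) \<and> (\<exists>\<epsilon>>0. K \<subseteq> L \<epsilon>)"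

text \<open>In the application these are exactly the Schwartz functions: compact support makes local
  constancy uniform, so a single radius serves all points.\<close>

definition step_functions :: "('x \<Rightarrow> 'r::idom) set" where
  "step_functions = {\<Phi>. (\<exists>\<epsilon>>0. \<forall>x. x \<notin> L \<epsilon> \<longrightarrow> \<Phi> x = 0) \<and>
     (\<exists>\<delta>>0. \<forall>x. \<forall>z\<in>L \<delta>. \<Phi> (x + z) = \<Phi> x)}"

lemma step_functionsI:
  assumes "\<epsilon> > 0" "\<And>x. x \<notin> L \<epsilon> \<Longrightarrow> \<Phi> x = 0" "\<delta> > 0" "\<And>x z. z \<in> L \<delta> \<Longrightarrow> \<Phi> (x + z) = \<Phi> x"
  shows "\<Phi> \<in> step_functions"
  using assms unfolding step_functions_def by blast

lemma step_functionsE: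
  assumes "\<Phi> \<in> step_functions"
  obtains \<epsilon> \<delta> where "\<epsilon> > 0" "\<And>x. x \<notin> L \<epsilon> \<Longrightarrow> \<Phi> x = 0" "\<delta> > 0" "\<And>x z. z \<in> L \<delta> \<Longrightarrow> \<Phi> (x + z) = \<Phi> x"
  using assms unfolding step_functions_def by blast

lemma lattice_L: "\<epsilon> > 0 \<Longrightarrow> lattice (L \<epsilon>)"
  using subgroup_L by (auto simp: lattice_def)

lemma lattice_subgroup: "lattice K \<Longrightarrow> add_subgroup K"
  by (simp add: lattice_def)

lemma lattice_transversal:
  assumes "lattice K" "lattice H" "H \<subseteq> K"
  obtains C where "transversal K H C"
proof -
  obtain \<epsilon> \<delta> where e: "\<epsilon> > 0" "K \<subseteq> L \<epsilon>" and d: "\<delta> > 0" "L \<delta> \<subseteq> H"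
    using assms by (auto simp: lattice_def)
  obtain D where D: "finite D" "\<forall>x\<in>L \<epsilon>. \<exists>d\<in>D. x - d \<in> L \<delta>"
    using L_finite_index[OF d(1) e(1)] by blast
  have "\<exists>d\<in>D. x - d \<in> H" if "x \<in> K" for x
    using D(2) e(2) d(2) that by blast
  then show ?thesis
    using transversal_exists[of H K D] assms D(1) that lattice_subgroup by blast
qed

text \<open>Local constancy with one radius for all points of \<open>K\<close>.
  \<open>\<phi>\<close> has this property on each lattice but in general not on all of X, and it is
  what makes the restriction of a function to \<open>K\<close> integrable.\<close>

definition unif :: "'x set \<Rightarrow> ('x \<Rightarrow> 'r::idom) \<Rightarrow> bool" where
  "unif K h \<longleftrightarrow> (\<exists>\<delta>>0. \<forall>x\<in>K. \<forall>z\<in>L \<delta>. h (x + z) = h x)"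

lemma L_subset_min:
  assumes "\<delta> > 0" "\<epsilon> > 0"
  shows "L (min \<delta> \<epsilon>) \<subseteq> L \<delta>" "L (min \<delta> \<epsilon>) \<subseteq> L \<epsilon>"
  using assms by (simp_all add: L_mono)

lemma L_subset_max:
  assumes "\<delta> > 0" "\<epsilon> > 0"
  shows "L \<delta> \<subseteq> L (max \<delta> \<epsilon>)" "L \<epsilon> \<subseteq> L (max \<delta> \<epsilon>)"
  using assms by (simp_all add: L_mono)

lemma restrict_step:
  assumes "lattice K" "unif K h"
  shows "(\<lambda>x. if x \<in> K then h x else 0) \<in> step_functions"
proof -
  obtain \<epsilon> \<delta> where e: "\<epsilon> > 0" "K \<subseteq> L \<epsilon>" and d: "\<delta> > 0" "L \<delta> \<subseteq> K"
    using assms by (auto simp: lattice_def)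
  obtain \<eta> where n: "\<eta> > 0" "\<forall>x\<in>K. \<forall>z\<in>L \<eta>. h (x + z) = h x"
    using assms(2) by (auto simp: unif_def)
  have "\<forall>z\<in>L (min \<delta> \<eta>). (if x + z \<in> K then h (x + z) else 0) = (if x \<in> K then h x else 0)" for x
  proof
    fix z assume "z \<in> L (min \<delta> \<eta>)"
    then have z: "z \<in> K" "z \<in> L \<eta>"
      using L_subset_min[OF d(1) n(1)] d(2) by auto
    show "(if x + z \<in> K then h (x + z) else 0) = (if x \<in> K then h x else 0)"
      using add_subgroup_add_iff[OF lattice_subgroup[OF assms(1)] z(1)] n(2) z(2) by simp
  qed
  then have "\<exists>\<delta>>0. \<forall>x. \<forall>z\<in>L \<delta>.
      (if x + z \<in> K then h (x + z) else 0) = (if x \<in> K then h x else 0)"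
    using d(1) n(1) by (intro exI[of _ "min \<delta> \<eta>"]) simp
  moreover have "\<exists>\<epsilon>>0. \<forall>x. x \<notin> L \<epsilon> \<longrightarrow> (if x \<in> K then h x else 0) = 0"
    using e by (auto intro!: exI[of _ \<epsilon>])
  ultimately show ?thesis by (simp add: step_functions_def)
qed

lemma unif_const: "unif K (\<lambda>_. c)"
  by (auto simp: unif_def intro: exI[of _ 1])

lemma unif_mult:
  assumes "unif K g" "unif K h"
  shows "unif K (\<lambda>x. g x * h x)"
proof -
  obtain \<delta> \<eta> where "\<delta> > 0" "\<forall>x\<in>K. \<forall>z\<in>L \<delta>. g (x + z) = g x"
     "\<eta> > 0" "\<forall>x\<in>K. \<forall>z\<in>L \<eta>. h (x + z) = h x"
    using assms by (auto simp: unif_def)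
  then show ?thesis
    using L_subset_min[of \<delta> \<eta>] unfolding unif_def
    by (intro exI[of _ "min \<delta> \<eta>"]) (simp add: subset_iff)
qed

lemma unif_step: "\<Phi> \<in> step_functions \<Longrightarrow> unif K \<Phi>"
  by (auto simp: step_functions_def unif_def)

lemma step_support:
  assumes "\<Phi> \<in> step_functions"
  obtains \<epsilon> where "\<epsilon> > 0" "\<And>\<epsilon>' x. \<epsilon> \<le> \<epsilon>' \<Longrightarrow> x \<notin> L \<epsilon>' \<Longrightarrow> \<Phi> x = 0"
proof -
  obtain \<epsilon> where "\<epsilon> > 0" "\<forall>x. x \<notin> L \<epsilon> \<longrightarrow> \<Phi> x = 0"
    using assms by (auto simp: step_functions_def)
  then show ?thesis using that L_mono by blast
qed

end

section \<open>Integration as finite summation over cosets\<close>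

locale haar_functional = filtered_group L for L :: "real \<Rightarrow> 'x::ab_group_add set" +
  fixes \<mu> :: "('x \<Rightarrow> 'r::idom) \<Rightarrow> 'r"
  assumes mu_add: "\<Phi> \<in> step_functions \<Longrightarrow> \<Psi> \<in> step_functions \<Longrightarrow>
      \<mu> (\<lambda>x. \<Phi> x + \<Psi> x) = \<mu> \<Phi> + \<mu> \<Psi>"
    and mu_scale: "\<Phi> \<in> step_functions \<Longrightarrow> \<mu> (\<lambda>x. c * \<Phi> x) = c * \<mu> \<Phi>"
    and mu_translate: "\<Phi> \<in> step_functions \<Longrightarrow> \<mu> (\<lambda>x. \<Phi> (g + x)) = \<mu> \<Phi>"
begin

lemma step_scale: "\<Phi> \<in> step_functions \<Longrightarrow> (\<lambda>x. c * \<Phi> x) \<in> step_functions"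
  by (fastforce simp: step_functions_def)

lemma step_add:
  assumes "\<Phi> \<in> step_functions" "\<Psi> \<in> step_functions"
  shows "(\<lambda>x. \<Phi> x + \<Psi> x) \<in> step_functions"
proof -
  obtain \<epsilon> \<epsilon>' \<delta> \<delta>' where *: "\<epsilon> > 0" "\<forall>x. x \<notin> L \<epsilon> \<longrightarrow> \<Phi> x = 0" "\<epsilon>' > 0" "\<forall>x. x \<notin> L \<epsilon>' \<longrightarrow> \<Psi> x = 0"
    "\<delta> > 0" "\<forall>x. \<forall>z\<in>L \<delta>. \<Phi> (x + z) = \<Phi> x" "\<delta>' > 0" "\<forall>x. \<forall>z\<in>L \<delta>'. \<Psi> (x + z) = \<Psi> x"
    using assms by (auto simp: step_functions_def)
  have "\<forall>x. x \<notin> L (max \<epsilon> \<epsilon>') \<longrightarrow> \<Phi> x + \<Psi> x = 0"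
    using * L_subset_max[of \<epsilon> \<epsilon>'] by (metis add_0 subsetD)
  moreover have "\<forall>x. \<forall>z\<in>L (min \<delta> \<delta>'). \<Phi> (x + z) + \<Psi> (x + z) = \<Phi> x + \<Psi> x"
    using * L_subset_min[of \<delta> \<delta>'] by (metis subsetD)
  ultimately show ?thesis
    using *(1,3,5,7) by (intro step_functionsI[of "max \<epsilon> \<epsilon>'" _ "min \<delta> \<delta>'"]) auto
qed

lemma step_zero: "(\<lambda>_. 0) \<in> step_functions"
  by (auto simp: step_functions_def intro: exI[of _ 1])

lemma step_translate:
  assumes "\<Phi> \<in> step_functions"
  shows "(\<lambda>x. \<Phi> (g + x)) \<in> step_functions"
proof -
  obtain \<epsilon> \<delta> \<eta> where e: "\<epsilon> > 0" "\<forall>x. x \<notin> L \<epsilon> \<longrightarrow> \<Phi> x = 0"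
    and d: "\<delta> > 0" "\<forall>x. \<forall>z\<in>L \<delta>. \<Phi> (x + z) = \<Phi> x" and n: "\<eta> > 0" "g \<in> L \<eta>"
    using assms L_exhaust[of g] by (auto simp: step_functions_def)
  have "\<Phi> (g + x) = 0" if "x \<notin> L (max \<epsilon> \<eta>)" for x
  proof -
    have "g \<in> L (max \<epsilon> \<eta>)" using n L_subset_max[OF e(1) n(1)] by auto
    then have "x + g \<notin> L (max \<epsilon> \<eta>)"
      using that add_subgroup_add_iff[OF subgroup_L, of "max \<epsilon> \<eta>" g x] n(1) by (simp add: max_def)
    then have "g + x \<notin> L \<epsilon>" using L_subset_max[OF e(1) n(1)] by (auto simp: add.commute)
    then show ?thesis using e(2) by blast
  qed
  moreover have "\<forall>x. \<forall>z\<in>L \<delta>. \<Phi> (g + (x + z)) = \<Phi> (g + x)"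
    using d(2) by (simp flip: add.assoc)
  ultimately show ?thesis
    using e(1) d(1) by (intro step_functionsI[of "max \<epsilon> \<eta>" _ \<delta>]) auto
qed

lemma mu_sum:
  assumes "finite A" "\<And>i. i \<in> A \<Longrightarrow> \<Phi> i \<in> step_functions"
  shows "(\<lambda>x. \<Sum>i\<in>A. \<Phi> i x) \<in> step_functions \<and> \<mu> (\<lambda>x. \<Sum>i\<in>A. \<Phi> i x) = (\<Sum>i\<in>A. \<mu> (\<Phi> i))"
  using assms
proof (induction A rule: finite_induct)
  case empty
  show ?case using mu_scale[OF step_zero, of 0] step_zero by simp
next
  case (insert i A)
  then show ?case using mu_add[of "\<Phi> i" "\<lambda>x. \<Sum>i\<in>A. \<Phi> i x"] step_add[of "\<Phi> i" "\<lambda>x. \<Sum>i\<in>A. \<Phi> i x"]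
    by simp
qed

text \<open>Cut off to \<open>K\<close>, a function invariant under \<open>H\<close> is a finite
  combination of translated indicators of \<open>H\<close>, and all translates have the same
  integral.\<close>

lemma integral_eq_sum:
  assumes K: "lattice K" and H: "lattice H" and HK: "H \<subseteq> K" and C: "transversal K H C"
    and h: "\<And>x z. x \<in> K \<Longrightarrow> z \<in> H \<Longrightarrow> h (x + z) = h x"
  shows "integral_over \<mu> K h = vol \<mu> H * sum h C"
proof -
  define I where "I x = (if x \<in> H then 1 else 0 :: 'r)" for x
  have I: "I \<in> step_functions"
    using restrict_step[OF H unif_const[of H 1]] by (simp add: I_def[abs_def])
  have finC: "finite C" and CK: "C \<subseteq> K" using C by (auto simp: transversal_def)
  have eq: "(if x \<in> K then h x else 0) = (\<Sum>c\<in>C. h c * I (- c + x))" for x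
  proof (cases "x \<in> K")
    case True
    then obtain c where c: "c \<in> C" "x - c \<in> H" "\<And>c'. c' \<in> C \<Longrightarrow> x - c' \<in> H \<Longrightarrow> c' = c"
      using C unfolding transversal_def by metis
    have "(\<Sum>c'\<in>C. h c' * I (- c' + x)) = (\<Sum>c'\<in>C. if c' = c then h c else 0)"
    proof (rule sum.cong)
      fix d assume "d \<in> C"
      then have "x - d \<in> H \<longleftrightarrow> d = c" using c by blast
      then show "h d * I (- d + x) = (if d = c then h c else 0)" by (simp add: I_def)
    qed simp
    also have "\<dots> = h (c + (x - c))"
      using h[of c "x - c"] c(1,2) finC CK by auto
    finally show ?thesis using True by simp
  next
    case False
    have "- c + x \<notin> H" if "c \<in> C" for c
      using add_subgroup_diff_iff[OF lattice_subgroup[OF K], of c x] that CK HK False by auto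
    then show ?thesis using False by (simp add: I_def)
  qed
  have "integral_over \<mu> K h = \<mu> (\<lambda>x. \<Sum>c\<in>C. h c * I (- c + x))"
    unfolding integral_over_def eq ..
  also have "\<dots> = (\<Sum>c\<in>C. \<mu> (\<lambda>x. h c * I (- c + x)))"
    using mu_sum[OF finC, of "\<lambda>c x. h c * I (- c + x)"] step_scale step_translate[OF I] by blast
  also have "\<dots> = (\<Sum>c\<in>C. h c * \<mu> I)"
    by (simp only: mu_scale[OF step_translate[OF I]] mu_translate[OF I])
  also have "\<mu> I = vol \<mu> H"
    by (simp add: vol_def integral_over_def I_def[abs_def])
  finally show ?thesis by (simp add: sum_distrib_left mult.commute)
qed

lemma vol_eq_card:
  assumes "lattice K" "lattice H" "H \<subseteq> K" "transversal K H C"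
  shows "vol \<mu> K = of_nat (card C) * vol \<mu> H"
  using integral_eq_sum[OF assms, of "\<lambda>_. 1"] by (simp add: vol_def[of _ K] mult.commute)

lemma vol_dvd:
  assumes "lattice K" "lattice H" "H \<subseteq> K"
  shows "vol \<mu> H dvd vol \<mu> K"
  by (rule lattice_transversal[OF assms]) (simp add: vol_eq_card[OF assms])

text \<open>The image of \<open>L \<epsilon>\<close> under the contraction lies in \<open>V\<close>,
  so its volume divides 1. That volume is the index of \<open>V\<close> in
  \<open>L \<epsilon>\<close> times another volume, since the contraction preserves the index. Hence
  the index is a unit; it is also the volume of \<open>L \<epsilon>\<close>, which
  \<open>vol \<mu> K\<close> divides.\<close>

lemma vol_unit:
  assumes V: "lattice V" "vol \<mu> V = 1" and K: "lattice K"
    and contract: "\<And>\<epsilon> \<delta>. \<epsilon> > 0 \<Longrightarrow> \<delta> > 0 \<Longrightarrow> \<exists>\<sigma>. inj \<sigma> \<and> (\<forall>x y. \<sigma> (x - y) = \<sigma> x - \<sigma> y) \<and>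
       \<sigma> ` L \<epsilon> \<subseteq> L \<delta> \<and> (\<forall>\<eta>>0. \<exists>\<eta>'>0. L \<eta>' \<subseteq> \<sigma> ` L \<eta>)"
  shows "vol \<mu> K dvd 1"
proof -
  obtain \<epsilon>1 \<epsilon>2 \<delta> where e: "\<epsilon>1 > 0" "K \<subseteq> L \<epsilon>1" "\<epsilon>2 > 0" "V \<subseteq> L \<epsilon>2" and d: "\<delta> > 0" "L \<delta> \<subseteq> V"
    using V(1) K by (auto simp: lattice_def)
  define \<epsilon> where "\<epsilon> = max \<epsilon>1 \<epsilon>2"
  have \<epsilon>: "\<epsilon> > 0" "K \<subseteq> L \<epsilon>" "V \<subseteq> L \<epsilon>"
    using e L_subset_max[OF e(1,3)] by (auto simp: \<epsilon>_def less_max_iff_disj)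
  obtain \<sigma> where \<sigma>: "inj \<sigma>" "\<And>x y. \<sigma> (x - y) = \<sigma> x - \<sigma> y" "\<sigma> ` L \<epsilon> \<subseteq> L \<delta>"
    "\<And>\<eta>. \<eta> > 0 \<Longrightarrow> \<exists>\<eta>'>0. L \<eta>' \<subseteq> \<sigma> ` L \<eta>"
    using contract[OF \<epsilon>(1) d(1)] by metis
  have lat: "lattice (\<sigma> ` M)" if M: "lattice M" "M \<subseteq> L \<epsilon>" for M
    unfolding lattice_def
  proof (intro conjI)
    have M0: "add_subgroup M" using M(1) by (rule lattice_subgroup)
    show "add_subgroup (\<sigma> ` M)"
    proof (rule add_subgroupI)
      show "0 \<in> \<sigma> ` M" using add_subgroup_zero[OF M0] \<sigma>(2)[of 0 0] by force
      show "x - y \<in> \<sigma> ` M" if "x \<in> \<sigma> ` M" "y \<in> \<sigma> ` M" for x y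
        using that add_subgroup_diff[OF M0] by (auto simp flip: \<sigma>(2))
    qed
    obtain \<eta> where n: "\<eta> > 0" "L \<eta> \<subseteq> M" using M(1) by (auto simp: lattice_def)
    show "\<exists>\<eta>>0. L \<eta> \<subseteq> \<sigma> ` M" using \<sigma>(4)[OF n(1)] n(2) by (meson image_mono order_trans)
    show "\<exists>\<epsilon>>0. \<sigma> ` M \<subseteq> L \<epsilon>" using \<sigma>(3) M(2) d(1) by (meson image_mono order_trans)
  qed
  have lats: "lattice (L \<epsilon>)" "lattice (\<sigma> ` V)" "lattice (\<sigma> ` L \<epsilon>)"
    using lattice_L lat V(1) \<epsilon> by auto
  obtain C where C: "transversal (L \<epsilon>) V C"
    using lattice_transversal[OF lats(1) V(1) \<epsilon>(3)] .
  have "vol \<mu> (\<sigma> ` L \<epsilon>) = of_nat (card (\<sigma> ` C)) * vol \<mu> (\<sigma> ` V)"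
    using vol_eq_card[OF lats(3,2) _ transversal_image[OF C \<sigma>(1,2)]] \<epsilon>(3) by blast
  moreover have "card (\<sigma> ` C) = card C"
    using \<sigma>(1) by (meson card_image inj_on_subset subset_UNIV)
  moreover have "vol \<mu> (\<sigma> ` L \<epsilon>) dvd 1"
    using vol_dvd[OF V(1) lats(3)] \<sigma>(3) d(2) V(2) by auto
  ultimately have "of_nat (card C) dvd (1::'r)"
    by (metis dvd_mult_left)
  moreover have "vol \<mu> (L \<epsilon>) = of_nat (card C)"
    using vol_eq_card[OF lats(1) V(1) \<epsilon>(3) C] V(2) by simp
  ultimately show ?thesis
    using vol_dvd[OF lats(1) K \<epsilon>(2)] by (metis dvd_trans)
qed

lemma integral_cong:
  "(\<And>x. x \<in> K \<Longrightarrow> g x = h x) \<Longrightarrow> integral_over \<mu> K g = integral_over \<mu> K h"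
  unfolding integral_over_def by (rule arg_cong[of _ _ \<mu>]) auto

lemma integral_scale:
  assumes "lattice K" "unif K h"
  shows "integral_over \<mu> K (\<lambda>x. c * h x) = c * integral_over \<mu> K h"
proof -
  have "integral_over \<mu> K (\<lambda>x. c * h x) = \<mu> (\<lambda>x. c * (if x \<in> K then h x else 0))"
    unfolding integral_over_def by (rule arg_cong[of _ _ \<mu>]) auto
  then show ?thesis using mu_scale[OF restrict_step[OF assms]] by (simp add: integral_over_def)
qed

lemma integral_translate:
  assumes "lattice K" "unif K h" "k \<in> K"
  shows "integral_over \<mu> K (\<lambda>x. h (x + k)) = integral_over \<mu> K h"
proof -
  have "(if x \<in> K then h (x + k) else 0) = (if k + x \<in> K then h (k + x) else 0)" for x
    using add_subgroup_add_iff[OF lattice_subgroup[OF assms(1)] assms(3), of x]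
    by (simp add: add.commute)
  then show ?thesis
    using mu_translate[OF restrict_step[OF assms(1,2)], of k]
    by (simp add: integral_over_def)
qed

lemma integral_step:
  assumes "\<And>x. x \<notin> K \<Longrightarrow> h x = 0"
  shows "integral_over \<mu> K h = \<mu> h"
  unfolding integral_over_def by (rule arg_cong[of _ _ \<mu>]) (use assms in auto)

text \<open>With one subgroup \<open>H\<close> fine enough for both variables, both sides are the
  same finite double sum. The radius \<open>\<delta>\<close> has to be uniform in the other variable
  for such an \<open>H\<close> to exist.\<close>

lemma integral_swap:
  assumes K: "lattice K" "lattice M" and \<delta>: "\<delta> > 0"
    and h: "\<And>x y z. x \<in> K \<Longrightarrow> y \<in> M \<Longrightarrow> z \<in> L \<delta> \<Longrightarrow> h (x + z) y = h x y"
      "\<And>x y z. x \<in> K \<Longrightarrow> y \<in> M \<Longrightarrow> z \<in> L \<delta> \<Longrightarrow> h x (y + z) = h x y"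
  shows "integral_over \<mu> K (\<lambda>x. integral_over \<mu> M (h x)) =
    integral_over \<mu> M (\<lambda>y. integral_over \<mu> K (\<lambda>x. h x y))"
proof -
  obtain \<delta>1 \<delta>2 where d: "\<delta>1 > 0" "L \<delta>1 \<subseteq> K" "\<delta>2 > 0" "L \<delta>2 \<subseteq> M"
    using K by (auto simp: lattice_def)
  define \<eta> where "\<eta> = min \<delta> (min \<delta>1 \<delta>2)"
  define H where "H = L \<eta>"
  have "\<eta> > 0" using d \<delta> by (simp add: \<eta>_def)
  then have H: "lattice H" by (simp add: H_def lattice_L)
  have "H \<subseteq> L \<delta>1" "H \<subseteq> L \<delta>2" "H \<subseteq> L \<delta>"
    unfolding H_def by (rule L_mono[OF \<open>\<eta> > 0\<close>]; simp add: \<eta>_def)+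
  then have HK: "H \<subseteq> K" "H \<subseteq> M" "H \<subseteq> L \<delta>"
    using d by auto
  obtain C where C: "transversal K H C" by (rule lattice_transversal[OF K(1) H HK(1)])
  obtain D where D: "transversal M H D" by (rule lattice_transversal[OF K(2) H HK(2)])
  have CK: "C \<subseteq> K" "D \<subseteq> M" using C D by (auto simp: transversal_def)
  have 1: "integral_over \<mu> M (h x) = vol \<mu> H * sum (h x) D" if "x \<in> K" for x
    by (rule integral_eq_sum[OF K(2) H HK(2) D]) (use that HK h in blast)
  have 2: "integral_over \<mu> K (\<lambda>x. h x y) = vol \<mu> H * (\<Sum>x\<in>C. h x y)" if "y \<in> M" for y
    by (rule integral_eq_sum[OF K(1) H HK(1) C]) (use that HK h in blast)
  have 3: "integral_over \<mu> M (h (x + z)) = integral_over \<mu> M (h x)" if "x \<in> K" "z \<in> H" for x z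
    by (rule integral_cong) (use h that HK in blast)
  have 4: "integral_over \<mu> K (\<lambda>x. h x (y + z)) = integral_over \<mu> K (\<lambda>x. h x y)"
    if "y \<in> M" "z \<in> H" for y z
    by (rule integral_cong) (use h that HK in blast)
  have "integral_over \<mu> K (\<lambda>x. integral_over \<mu> M (h x)) = vol \<mu> H * (\<Sum>x\<in>C. integral_over \<mu> M (h x))"
    by (rule integral_eq_sum[OF K(1) H HK(1) C]) (use 3 in blast)
  also have "(\<Sum>x\<in>C. integral_over \<mu> M (h x)) = (\<Sum>x\<in>C. vol \<mu> H * sum (h x) D)"
    by (rule sum.cong) (use 1 CK in auto)
  also have "\<dots> = (\<Sum>y\<in>D. vol \<mu> H * (\<Sum>x\<in>C. h x y))"
    unfolding sum_distrib_left by (rule sum.swap)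
  also have "\<dots> = (\<Sum>y\<in>D. integral_over \<mu> K (\<lambda>x. h x y))"
    by (rule sum.cong) (use 2 CK in auto)
  also have "vol \<mu> H * \<dots> = integral_over \<mu> M (\<lambda>y. integral_over \<mu> K (\<lambda>x. h x y))"
    by (rule integral_eq_sum[OF K(2) H HK(2) D, symmetric]) (use 4 in blast)
  finally show ?thesis .
qed

text \<open>Orthogonality: translating by \<open>k\<close> multiplies the integral by
  \<open>\<psi> k\<close>, and 1 - \<open>\<psi> k\<close> cancels in a domain unless it is
  0.\<close>

lemma integral_character:
  assumes K: "lattice K" and u: "unif K \<psi>" and add: "\<And>x y. \<psi> (x + y) = \<psi> x * \<psi> y"
  shows "integral_over \<mu> K \<psi> = (if \<forall>x\<in>K. \<psi> x = 1 then vol \<mu> K else 0)"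
proof (cases "\<forall>x\<in>K. \<psi> x = 1")
  case True
  then show ?thesis using integral_cong[of K \<psi> "\<lambda>_. 1"] by (simp add: vol_def)
next
  case False
  then obtain k where k: "k \<in> K" "\<psi> k \<noteq> 1" by blast
  have "integral_over \<mu> K \<psi> = integral_over \<mu> K (\<lambda>x. \<psi> k * \<psi> x)"
    using integral_translate[OF K u k(1)] by (simp add: add mult.commute)
  also have "\<dots> = \<psi> k * integral_over \<mu> K \<psi>" by (rule integral_scale[OF K u])
  finally have "(1 - \<psi> k) * integral_over \<mu> K \<psi> = 0" by (simp add: algebra_simps)
  then have "integral_over \<mu> K \<psi> = 0" using k(2) by simp
  then show ?thesis using False by (simp only: if_False)
qed

end

section \<open>The Weil factor of a character of second degree\<close>

text \<open>For \<open>B\<close> coming from \<open>\<rho>\<close>, this is the preimage under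
  \<open>\<rho>\<close> of the annihilator of \<open>H\<close> in the dual.\<close>

definition perp :: "('x \<Rightarrow> 'x \<Rightarrow> 'r::idom) \<Rightarrow> 'x set \<Rightarrow> 'x set" where
  "perp B H = {x. \<forall>z\<in>H. B x z = 1}"

text \<open>\<open>\<phi>\<close> is a character of second degree with associated bicharacter
  \<open>B\<close>, and \<open>\<phi>i\<close> is its pointwise inverse, carried along because
  \<open>R\<close> has no division. Non-degeneracy appears quantitatively:
  \<open>perp_bounded\<close> bounds the support of transforms, \<open>perp_small\<close> makes
  \<open>\<phi>\<close> trivial on orthogonals of large lattices.\<close>

locale weil_setting = haar_functional L \<mu>
  for L :: "real \<Rightarrow> 'x::ab_group_add set" and \<mu> :: "('x \<Rightarrow> 'r::idom) \<Rightarrow> 'r" +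
  fixes B :: "'x \<Rightarrow> 'x \<Rightarrow> 'r" and \<phi> \<phi>i :: "'x \<Rightarrow> 'r"
  assumes B_add_left: "B (x + y) z = B x z * B y z"
    and B_sym: "B x y = B y x"
    and B_zero: "B 0 y = 1"
    and phi_add: "\<phi> (x + y) = \<phi> x * \<phi> y * B x y"
    and phi_minus: "\<phi> (- x) = \<phi> x"
    and phi_inv: "\<phi> x * \<phi>i x = 1"
    and phi_trivial: "\<exists>\<eta>>0. \<forall>x\<in>L \<eta>. \<phi> x = 1"
    and B_trivial: "\<epsilon> > 0 \<Longrightarrow> \<exists>\<delta>>0. \<forall>x\<in>L \<epsilon>. \<forall>z\<in>L \<delta>. B x z = 1"
    and perp_bounded: "\<delta> > 0 \<Longrightarrow> \<exists>\<epsilon>>0. perp B (L \<delta>) \<subseteq> L \<epsilon>"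
    and perp_small: "\<delta> > 0 \<Longrightarrow> \<exists>\<epsilon>>0. perp B (L \<epsilon>) \<subseteq> L \<delta>"
    and unit_vol: "lattice K \<Longrightarrow> vol \<mu> K dvd 1"
begin

lemma B_add_right: "B z (x + y) = B z x * B z y"
  using B_add_left[of x y z] by (simp add: B_sym)

lemma B_minus_mult: "B (- x) y * B x y = 1"
  using B_add_left[of "- x" x y] B_zero by simp

text \<open>In \<open>phi_add\<close> both \<open>\<phi> z\<close> and \<open>B x z\<close> become 1
  for small z. The second requires a bound on x, so \<open>\<delta>\<close> depends on
  \<open>\<epsilon>\<close>.\<close>

lemma phi_locally_constant:
  assumes "\<epsilon> > 0"
  obtains \<delta> where "\<delta> > 0" "\<And>x z. x \<in> L \<epsilon> \<Longrightarrow> z \<in> L \<delta> \<Longrightarrow> B x z = 1"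
    "\<And>x z. x \<in> L \<epsilon> \<Longrightarrow> z \<in> L \<delta> \<Longrightarrow> \<phi> (x + z) = \<phi> x"
proof -
  obtain \<eta> \<delta> where n: "\<eta> > 0" "\<forall>x\<in>L \<eta>. \<phi> x = 1" "\<delta> > 0" "\<forall>x\<in>L \<epsilon>. \<forall>z\<in>L \<delta>. B x z = 1"
    using phi_trivial B_trivial[OF assms] by blast
  show ?thesis
    by (rule that[of "min \<eta> \<delta>"])
      (use n L_subset_min[OF n(1,3)] in \<open>auto simp: phi_add subset_iff\<close>)
qed

lemma phi_nonzero: "\<phi> x \<noteq> 0"
  using phi_inv[of x] by auto

lemma phi_inv_eqI: "\<phi> y = \<phi> x \<Longrightarrow> \<phi>i y = \<phi>i x"
  using phi_inv[of x] phi_inv[of y] phi_nonzero[of x] by (metis mult_left_cancel)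

lemma unif_phi:
  assumes "lattice K"
  shows "unif K \<phi>" "unif K \<phi>i" "unif K (B y)"
proof -
  obtain \<epsilon>1 \<epsilon>2 where e: "\<epsilon>1 > 0" "K \<subseteq> L \<epsilon>1" "\<epsilon>2 > 0" "y \<in> L \<epsilon>2"
    using assms L_exhaust[of y] by (auto simp: lattice_def)
  obtain \<delta> where d: "\<delta> > 0" "\<And>x z. x \<in> L (max \<epsilon>1 \<epsilon>2) \<Longrightarrow> z \<in> L \<delta> \<Longrightarrow> B x z = 1"
    "\<And>x z. x \<in> L (max \<epsilon>1 \<epsilon>2) \<Longrightarrow> z \<in> L \<delta> \<Longrightarrow> \<phi> (x + z) = \<phi> x"
    using phi_locally_constant[of "max \<epsilon>1 \<epsilon>2"] e by (metis less_max_iff_disj)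
  have K: "x \<in> L (max \<epsilon>1 \<epsilon>2)" if "x \<in> K" for x using that e L_subset_max[OF e(1,3)] by blast
  have y: "y \<in> L (max \<epsilon>1 \<epsilon>2)" using e L_subset_max[OF e(1,3)] by blast
  show "unif K \<phi>" using d(1,3) K unfolding unif_def by blast
  show "unif K \<phi>i" using d(1,3) K phi_inv_eqI unfolding unif_def by blast
  show "unif K (B y)" using d(1) d(2)[OF y] unfolding unif_def by (auto simp: B_add_right)
qed

lemma integral_B:
  assumes "lattice K"
  shows "integral_over \<mu> K (B y) = (if y \<in> perp B K then vol \<mu> K else 0)"
  using integral_character[OF assms unif_phi(3)[OF assms] B_add_right] by (simp add: perp_def)

text \<open>Exchange the integrals, then expand \<open>\<phi> (x + y)\<close>. With \<open>h\<close>
  = 1 on a lattice where \<open>\<phi>\<close> is trivial, and again with \<open>h\<close> =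
  \<open>\<phi>i\<close>, the inner integral on the right is that of the character
  \<open>B x\<close>, so orthogonality applies.\<close>

lemma integral_double_shift:
  assumes K: "lattice K" and H: "lattice H" and HK: "H \<subseteq> K" and h: "unif H h"
  shows "integral_over \<mu> H (\<lambda>y. h y * integral_over \<mu> K (\<lambda>x. \<phi> (x + y))) =
    integral_over \<mu> K (\<lambda>x. \<phi> x * integral_over \<mu> H (\<lambda>y. h y * \<phi> y * B x y))"
proof -
  obtain \<epsilon> \<eta> \<delta>0 where e: "\<epsilon> > 0" "K \<subseteq> L \<epsilon>" and n: "\<eta> > 0" "\<And>x z. x \<in> H \<Longrightarrow> z \<in> L \<eta> \<Longrightarrow> h (x + z) = h x"
    using K h by (auto simp: lattice_def unif_def)
  obtain \<delta> where d: "\<delta> > 0" "\<And>x z. x \<in> L \<epsilon> \<Longrightarrow> z \<in> L \<delta> \<Longrightarrow> \<phi> (x + z) = \<phi> x"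
    using phi_locally_constant[OF e(1)] by metis
  have phi: "\<phi> (x + y + z) = \<phi> (x + y)" "\<phi> (x + z + y) = \<phi> (x + y)"
    if "x \<in> K" "y \<in> H" "z \<in> L (min \<delta> \<eta>)" for x y z
  proof -
    have "x + y \<in> L \<epsilon>" using add_subgroup_add[OF lattice_subgroup[OF K]] that HK e(2) by blast
    then show "\<phi> (x + y + z) = \<phi> (x + y)" using d(2) that L_subset_min[OF d(1) n(1)] by blast
    then show "\<phi> (x + z + y) = \<phi> (x + y)" by (simp add: ac_simps)
  qed
  have uK: "unif K (\<lambda>x. \<phi> (x + y))" if "y \<in> H" for y
    unfolding unif_def using phi(2)[OF _ that] d(1) n(1) by (intro exI[of _ "min \<delta> \<eta>"]) auto
  have "integral_over \<mu> H (\<lambda>y. h y * integral_over \<mu> K (\<lambda>x. \<phi> (x + y))) =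
      integral_over \<mu> H (\<lambda>y. integral_over \<mu> K (\<lambda>x. h y * \<phi> (x + y)))"
    by (rule integral_cong) (simp add: integral_scale[OF K uK])
  also have "\<dots> = integral_over \<mu> K (\<lambda>x. integral_over \<mu> H (\<lambda>y. h y * \<phi> (x + y)))"
    by (rule integral_swap[OF H K, of "min \<delta> \<eta>"])
      (use d(1) n phi L_subset_min[OF d(1) n(1)] in \<open>auto simp: subset_iff simp flip: add.assoc\<close>)
  also have "\<dots> = integral_over \<mu> K (\<lambda>x. integral_over \<mu> H (\<lambda>y. \<phi> x * (h y * \<phi> y * B x y)))"
    by (simp add: phi_add ac_simps)
  also have "\<dots> = integral_over \<mu> K (\<lambda>x. \<phi> x * integral_over \<mu> H (\<lambda>y. h y * \<phi> y * B x y))"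
    by (rule integral_cong, rule integral_scale[OF H]) (intro unif_mult h unif_phi[OF H])
  finally show ?thesis .
qed

text \<open>Averaging over \<open>H\<close> kills \<open>\<phi>\<close> off the orthogonal of \<open>H\<close>.\<close>

lemma integral_phi_restrict_perp:
  assumes K: "lattice K" and H: "lattice H" and HK: "H \<subseteq> K" and triv: "\<And>x. x \<in> H \<Longrightarrow> \<phi> x = 1"
  shows "integral_over \<mu> K \<phi> = integral_over \<mu> (K \<inter> perp B H) \<phi>"
proof -
  have "vol \<mu> H * integral_over \<mu> K \<phi> =
      integral_over \<mu> H (\<lambda>y. 1 * integral_over \<mu> K (\<lambda>x. \<phi> (x + y)))"
  proof -
    have "integral_over \<mu> H (\<lambda>y. 1 * integral_over \<mu> K (\<lambda>x. \<phi> (x + y))) =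
        integral_over \<mu> H (\<lambda>y. integral_over \<mu> K \<phi> * 1)"
      by (rule integral_cong) (use integral_translate[OF K unif_phi(1)[OF K]] HK in auto)
    then show ?thesis using integral_scale[OF H unif_const[of H 1], of "integral_over \<mu> K \<phi>"]
      by (simp add: vol_def[of _ H] mult.commute)
  qed
  also have "\<dots> = integral_over \<mu> K (\<lambda>x. \<phi> x * integral_over \<mu> H (\<lambda>y. 1 * \<phi> y * B x y))"
    by (rule integral_double_shift[OF K H HK unif_const])
  also have "\<dots> = integral_over \<mu> K (\<lambda>x. vol \<mu> H * (if x \<in> perp B H then \<phi> x else 0))"
  proof (rule integral_cong)
    fix x
    have "integral_over \<mu> H (\<lambda>y. 1 * \<phi> y * B x y) = integral_over \<mu> H (B x)"
      by (rule integral_cong) (use triv in auto)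
    then show "\<phi> x * integral_over \<mu> H (\<lambda>y. 1 * \<phi> y * B x y) =
        vol \<mu> H * (if x \<in> perp B H then \<phi> x else 0)"
      by (simp add: integral_B[OF H])
  qed
  also have "\<dots> = vol \<mu> H * integral_over \<mu> K (\<lambda>x. if x \<in> perp B H then \<phi> x else 0)"
  proof (rule integral_scale[OF K])
    obtain \<epsilon> where e: "\<epsilon> > 0" "H \<subseteq> L \<epsilon>" using H by (auto simp: lattice_def)
    obtain \<delta> where d: "\<delta> > 0" "\<And>x z. x \<in> L \<epsilon> \<Longrightarrow> z \<in> L \<delta> \<Longrightarrow> B x z = 1"
      using phi_locally_constant[OF e(1)] by metis
    obtain \<eta> where n: "\<eta> > 0" "\<forall>x\<in>K. \<forall>z\<in>L \<eta>. \<phi> (x + z) = \<phi> x"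
      using unif_phi(1)[OF K] by (auto simp: unif_def)
    \<comment> \<open>The orthogonal of a bounded set is invariant under small translations, so
      cutting off to it preserves uniform local constancy.\<close>
    have "x + z \<in> perp B H \<longleftrightarrow> x \<in> perp B H" if "z \<in> L \<delta>" for x z
      using d(2) e(2) that unfolding perp_def by (auto simp: B_add_left B_sym[of z] subset_iff)
    then show "unif K (\<lambda>x. if x \<in> perp B H then \<phi> x else 0)"
      unfolding unif_def using n d(1) L_subset_min[OF d(1) n(1)]
      by (intro exI[of _ "min \<delta> \<eta>"]) (auto simp: subset_iff)
  qed
  also have "integral_over \<mu> K (\<lambda>x. if x \<in> perp B H then \<phi> x else 0) =
      integral_over \<mu> (K \<inter> perp B H) \<phi>"
    unfolding integral_over_def by (rule arg_cong[of _ _ \<mu>]) auto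
  \<comment> \<open>The common factor \<open>vol \<mu> H\<close> is a unit, hence non-zero, and
    cancels.\<close>
  finally show ?thesis using unit_vol[OF H] by auto
qed

text \<open>Only the part of \<open>K\<close> orthogonal to a small ball contributes, and that
  orthogonal already lies in \<open>K0\<close>. The triviality of \<open>\<phi>\<close> on the
  orthogonal of \<open>K0\<close> is what later shows the stable value to be a unit.\<close>

lemma integral_phi_stable:
  obtains K0 where "lattice K0" "\<And>x. x \<in> perp B K0 \<Longrightarrow> \<phi> x = 1"
    "\<And>K. lattice K \<Longrightarrow> K0 \<subseteq> K \<Longrightarrow> integral_over \<mu> K \<phi> = integral_over \<mu> K0 \<phi>"
proof -
  obtain \<eta> where n: "\<eta> > 0" "\<And>x. x \<in> L \<eta> \<Longrightarrow> \<phi> x = 1" using phi_trivial by blast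
  obtain \<epsilon>1 \<epsilon>2 where e: "\<epsilon>1 > 0" "perp B (L \<eta>) \<subseteq> L \<epsilon>1" "\<epsilon>2 > 0" "perp B (L \<epsilon>2) \<subseteq> L \<eta>"
    using perp_bounded[OF n(1)] perp_small[OF n(1)] by blast
  \<comment> \<open>The three radii serve different ends: \<open>\<eta>\<close> puts the averaging
    subgroup inside \<open>K0\<close>, \<open>\<epsilon>1\<close> its orthogonal, and
    \<open>\<epsilon>2\<close> forces the orthogonal of \<open>K0\<close> into the ball where
    \<open>\<phi>\<close> is 1.\<close>
  define K0 where "K0 = L (max \<eta> (max \<epsilon>1 \<epsilon>2))"
  have K0: "L \<eta> \<subseteq> K0" "L \<epsilon>1 \<subseteq> K0" "L \<epsilon>2 \<subseteq> K0"
    unfolding K0_def by (intro L_mono n e; simp)+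
  have lat: "lattice K0" unfolding K0_def by (rule lattice_L) (use n(1) in auto)
  have "integral_over \<mu> K \<phi> = integral_over \<mu> K0 \<phi>" if "lattice K" "K0 \<subseteq> K" for K
  proof -
    have "K \<inter> perp B (L \<eta>) = K0 \<inter> perp B (L \<eta>)" using that(2) e(2) K0(2) by blast
    then show ?thesis
      using integral_phi_restrict_perp[OF that(1) lattice_L[OF n(1)] _ n(2)]
        integral_phi_restrict_perp[OF lat lattice_L[OF n(1)] K0(1) n(2)] that(2) K0(1) by auto
  qed
  moreover have "\<phi> x = 1" if "x \<in> perp B K0" for x
    using that K0(3) e(4) n(2) unfolding perp_def by blast
  ultimately show ?thesis using that lat by blast
qed

text \<open>The Fourier transform composed with \<open>\<rho>\<close>, so that it is again a
  function on X.\<close>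

definition transform :: "('x \<Rightarrow> 'r) \<Rightarrow> 'x \<Rightarrow> 'r" where
  "transform \<Phi> y = \<mu> (\<lambda>x. \<Phi> x * B y x)"

lemma step_mult_B:
  assumes "\<Phi> \<in> step_functions"
  shows "(\<lambda>x. \<Phi> x * B y x) \<in> step_functions" "(\<lambda>x. \<Phi> x * \<phi> x) \<in> step_functions"
proof -
  obtain \<epsilon> where e: "\<epsilon> > 0" "\<And>x. x \<notin> L \<epsilon> \<Longrightarrow> \<Phi> x = 0"
    using step_support[OF assms] by (metis order_refl)
  have "(\<lambda>x. \<Phi> x * g x) \<in> step_functions" if "unif (L \<epsilon>) g" for g
  proof -
    have "(\<lambda>x. \<Phi> x * g x) = (\<lambda>x. if x \<in> L \<epsilon> then \<Phi> x * g x else 0)" using e(2) by auto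
    then show ?thesis
      using restrict_step[OF lattice_L[OF e(1)] unif_mult[OF unif_step[OF assms] that]] by simp
  qed
  then show "(\<lambda>x. \<Phi> x * B y x) \<in> step_functions" "(\<lambda>x. \<Phi> x * \<phi> x) \<in> step_functions"
    using unif_phi[OF lattice_L[OF e(1)]] by auto
qed

lemma step_uminus:
  assumes "\<Phi> \<in> step_functions"
  shows "(\<lambda>x. \<Phi> (- x)) \<in> step_functions"
proof -
  obtain \<epsilon> \<delta> where *: "\<epsilon> > 0" "\<And>x. x \<notin> L \<epsilon> \<Longrightarrow> \<Phi> x = 0" "\<delta> > 0" "\<And>x z. z \<in> L \<delta> \<Longrightarrow> \<Phi> (x + z) = \<Phi> x"
    using step_functionsE[OF assms] by metis
  show ?thesis
  proof (rule step_functionsI[OF *(1) _ *(3)])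
    show "\<Phi> (- x) = 0" if "x \<notin> L \<epsilon>" for x
      using * that add_subgroup_minus_iff[OF subgroup_L[OF *(1)]] by blast
    show "\<Phi> (- (x + z)) = \<Phi> (- x)" if "z \<in> L \<delta>" for x z
      using *(4)[of "- z" "- x"] that add_subgroup_minus_iff[OF subgroup_L[OF *(3)]] by simp
  qed
qed

text \<open>Support and invariance trade places: invariance of \<open>\<Phi>\<close> under a ball
  confines the transform to the orthogonal of that ball, and a bound on the support of
  \<open>\<Phi>\<close> makes the transform invariant under small translations.\<close>

lemma step_transform:
  assumes "\<Phi> \<in> step_functions"
  shows "transform \<Phi> \<in> step_functions"
proof -
  obtain \<epsilon> \<delta> where *: "\<epsilon> > 0" "\<And>x. x \<notin> L \<epsilon> \<Longrightarrow> \<Phi> x = 0" "\<delta> > 0" "\<And>x z. z \<in> L \<delta> \<Longrightarrow> \<Phi> (x + z) = \<Phi> x"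
    using step_functionsE[OF assms] by metis
  obtain \<delta>' where d: "\<delta>' > 0" "\<And>x z. x \<in> L \<epsilon> \<Longrightarrow> z \<in> L \<delta>' \<Longrightarrow> B x z = 1"
    using phi_locally_constant[OF *(1)] by metis
  obtain \<epsilon>' where e: "\<epsilon>' > 0" "perp B (L \<delta>) \<subseteq> L \<epsilon>'" using perp_bounded[OF *(3)] by blast
  show ?thesis
  proof (rule step_functionsI[OF e(1) _ d(1)])
    fix y assume "y \<notin> L \<epsilon>'"
    then obtain k where k: "k \<in> L \<delta>" "B y k \<noteq> 1" using e(2) by (auto simp: perp_def)
    have "transform \<Phi> y = \<mu> (\<lambda>x. \<Phi> (k + x) * B y (k + x))"
      using mu_translate[OF step_mult_B(1)[OF assms], of k y] by (simp add: transform_def)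
    also have "\<dots> = \<mu> (\<lambda>x. B y k * (\<Phi> x * B y x))"
      using *(4)[OF k(1)] by (simp add: B_add_right add.commute[of k] ac_simps)
    also have "\<dots> = B y k * transform \<Phi> y"
      using mu_scale[OF step_mult_B(1)[OF assms]] by (simp add: transform_def)
    finally have "(1 - B y k) * transform \<Phi> y = 0" by (simp add: algebra_simps)
    then show "transform \<Phi> y = 0" using k(2) by simp
  next
    fix y z assume z: "z \<in> L \<delta>'"
    show "transform \<Phi> (y + z) = transform \<Phi> y"
      unfolding transform_def
    proof (rule arg_cong[of _ _ \<mu>], rule ext)
      fix x
      show "\<Phi> x * B (y + z) x = \<Phi> x * B y x"
        using *(2)[of x] d(2)[OF _ z, of x] by (cases "x \<in> L \<epsilon>") (auto simp: B_add_left B_sym[of z])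
    qed
  qed
qed

text \<open>Expanding \<open>\<phi> (x - y)\<close> displays convolution as multiplication by
  \<open>\<phi>\<close>, then a transform read at -x, then multiplication by \<open>\<phi>\<close>.
  These are the three inner operators of \<open>weil_s\<close> up to a scalar, and the formula also
  shows that the convolution is a step function.\<close>

lemma convolution_eq:
  assumes "\<Phi> \<in> step_functions"
  shows "convolution \<mu> \<Phi> \<phi> x = \<phi> x * transform (\<lambda>y. \<Phi> y * \<phi> y) (- x)"
proof -
  have "\<Phi> y * \<phi> (x - y) = \<phi> x * (\<Phi> y * \<phi> y * B (- x) y)" for y
  proof -
    \<comment> \<open>Both sides are inverse to \<open>B x y\<close>.\<close>
    have "B x (- y) = B (- x) y"
      using B_minus_mult[of y x] B_minus_mult[of x y]
      by (metis B_sym mult.assoc mult.commute mult_1)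
    then show ?thesis using phi_add[of x "- y"] by (simp add: phi_minus ac_simps)
  qed
  then have "convolution \<mu> \<Phi> \<phi> x = \<mu> (\<lambda>y. \<phi> x * (\<Phi> y * \<phi> y * B (- x) y))"
    by (simp only: convolution_def)
  then show ?thesis
    using mu_scale[OF step_mult_B(1)[OF step_mult_B(2)[OF assms]]] by (simp add: transform_def)
qed

lemma step_convolution:
  assumes "\<Phi> \<in> step_functions"
  shows "convolution \<mu> \<Phi> \<phi> \<in> step_functions"
proof -
  have "convolution \<mu> \<Phi> \<phi> = (\<lambda>x. transform (\<lambda>y. \<Phi> y * \<phi> y) (- x) * \<phi> x)"
    using convolution_eq[OF assms] by (auto simp: mult.commute)
  then show ?thesis
    using step_mult_B(2)[OF step_uminus[OF step_transform[OF step_mult_B(2)[OF assms]]]] by simp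
qed

section \<open>The stable value \<open>G\<close>, an analogue of a Gauss sum\<close>

context
  fixes K0 G
  assumes K0: "lattice K0" "\<And>x. x \<in> perp B K0 \<Longrightarrow> \<phi> x = 1"
    and G: "\<And>K. lattice K \<Longrightarrow> K0 \<subseteq> K \<Longrightarrow> integral_over \<mu> K \<phi> = G"
begin

text \<open>The analogue of the absolute square of a Gauss sum: \<open>G\<close> times the integral
  of \<open>\<phi>i\<close> is a product of two volumes, both units.\<close>

lemma weil_integral_unit: "G dvd 1"
proof -
  obtain \<epsilon> where e: "\<epsilon> > 0" "K0 \<subseteq> L \<epsilon>" using K0(1) by (auto simp: lattice_def)
  obtain \<eta> where n: "\<eta> > 0" "perp B (L \<epsilon>) \<subseteq> L \<eta>" using perp_bounded[OF e(1)] by blast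
  \<comment> \<open>\<open>K\<close> must contain \<open>K0\<close>, so that the integral is
    \<open>G\<close> and \<open>\<phi>\<close> is 1 on the orthogonal of \<open>K\<close>; it must
    also contain that orthogonal, which lies in \<open>L \<eta>\<close>.\<close>
  define K where "K = L (max \<epsilon> \<eta>)"
  have K: "lattice K" "K0 \<subseteq> K" "L \<epsilon> \<subseteq> K" "L \<eta> \<subseteq> K"
    using e n L_subset_max[OF e(1) n(1)] lattice_L[of "max \<epsilon> \<eta>"] by (auto simp: K_def)
  have perp: "perp B K \<subseteq> perp B (L \<epsilon>)" "perp B K \<subseteq> perp B K0"
    using K(2,3) by (auto simp: perp_def)
  have latp: "lattice (perp B K)"
    unfolding lattice_def
  proof (intro conjI)
    show "add_subgroup (perp B K)"
    proof (rule add_subgroupI)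
      show "0 \<in> perp B K" by (simp add: perp_def B_zero)
      fix x y assume xy: "x \<in> perp B K" "y \<in> perp B K"
      have "B (x - y) z = 1" if "z \<in> K" for z
        using xy that B_add_left[of "x - y" y z] by (simp add: perp_def)
      then show "x - y \<in> perp B K" by (simp add: perp_def)
    qed
    obtain \<delta> where d: "\<delta> > 0" "\<And>x z. x \<in> K \<Longrightarrow> z \<in> L \<delta> \<Longrightarrow> B x z = 1"
      using phi_locally_constant[of "max \<epsilon> \<eta>"] e(1) unfolding K_def by (metis less_max_iff_disj)
    have "B z x = 1" if "z \<in> L \<delta>" "x \<in> K" for x z
      using d(2)[OF that(2,1)] by (simp add: B_sym[of z])
    then show "\<exists>\<delta>>0. L \<delta> \<subseteq> perp B K" using d(1) unfolding perp_def by blast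
    show "\<exists>\<epsilon>>0. perp B K \<subseteq> L \<epsilon>" using n perp(1) by blast
  qed
  have "G * integral_over \<mu> K \<phi>i = integral_over \<mu> K (\<lambda>y. \<phi>i y * integral_over \<mu> K (\<lambda>x. \<phi> (x + y)))"
  proof -
    have "integral_over \<mu> K (\<lambda>y. \<phi>i y * integral_over \<mu> K (\<lambda>x. \<phi> (x + y))) =
        integral_over \<mu> K (\<lambda>y. G * \<phi>i y)"
      by (rule integral_cong)
        (use integral_translate[OF K(1) unif_phi(1)[OF K(1)]] G[OF K(1,2)] in auto)
    then show ?thesis using integral_scale[OF K(1) unif_phi(2)[OF K(1)]] by simp
  qed
  also have "\<dots> = integral_over \<mu> K (\<lambda>x. \<phi> x * integral_over \<mu> K (\<lambda>y. \<phi>i y * \<phi> y * B x y))"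
    by (rule integral_double_shift[OF K(1,1) order_refl unif_phi(2)[OF K(1)]])
  \<comment> \<open>The inner integrand reduces to \<open>B x y\<close>, whose integral vanishes
    unless x is orthogonal to \<open>K\<close>, and there \<open>\<phi> x\<close> is 1.\<close>
  also have "\<dots> = integral_over \<mu> K (\<lambda>x. vol \<mu> K * (if x \<in> perp B K then 1 else 0))"
  proof (rule integral_cong)
    fix x
    have "\<phi>i y * \<phi> y = 1" for y using phi_inv[of y] by (simp add: mult.commute)
    then show "\<phi> x * integral_over \<mu> K (\<lambda>y. \<phi>i y * \<phi> y * B x y) =
        vol \<mu> K * (if x \<in> perp B K then 1 else 0)"
      using integral_B[OF K(1), of x] perp(2) K0(2) by auto
  qed
  also have "\<dots> = vol \<mu> K * integral_over \<mu> K (\<lambda>x. if x \<in> perp B K then 1 else 0)"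
    by (intro integral_scale K(1) unif_step restrict_step latp unif_const)
  also have "integral_over \<mu> K (\<lambda>x. if x \<in> perp B K then 1 else 0) = vol \<mu> (perp B K)"
  proof -
    have "perp B K \<subseteq> K" using perp(1) n(2) K(4) by blast
    then show ?thesis
      unfolding vol_def integral_over_def by (intro arg_cong[of _ _ \<mu>] ext) auto
  qed
  finally have *: "G * integral_over \<mu> K \<phi>i = vol \<mu> K * vol \<mu> (perp B K)" .
  have "vol \<mu> K * vol \<mu> (perp B K) dvd 1 * 1"
    by (rule mult_dvd_mono[OF unit_vol[OF K(1)] unit_vol[OF latp]])
  then show ?thesis unfolding *[symmetric] by (auto intro: dvd_mult_left)
qed

text \<open>Completing the square replaces x by x + y, and \<open>y \<in> K\<close> is what makes
  this translation preserve \<open>K\<close>.\<close>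

lemma integral_phi_B:
  assumes K: "lattice K" "K0 \<subseteq> K" and y: "y \<in> K"
  shows "integral_over \<mu> K (\<lambda>x. \<phi> x * B y x) = G * \<phi>i y"
proof -
  have "\<phi> x * B y x = \<phi>i y * \<phi> (x + y)" for x
    using phi_inv[of y] by (simp add: phi_add B_sym[of x] ac_simps)
  moreover have "unif K (\<lambda>x. \<phi> (x + y))"
  proof -
    have "unif K (\<lambda>x. \<phi> y * (\<phi> x * B y x))"
      by (intro unif_mult unif_const unif_phi K(1))
    then show ?thesis by (simp add: phi_add B_sym ac_simps)
  qed
  ultimately have "integral_over \<mu> K (\<lambda>x. \<phi> x * B y x) = \<phi>i y * integral_over \<mu> K (\<lambda>x. \<phi> (x + y))"
    using integral_scale[OF K(1)] by simp
  then show ?thesis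
    using integral_translate[OF K(1) unif_phi(1)[OF K(1)] y] G[OF K] by (simp add: mult.commute)
qed

text \<open>After the exchange of integrals, shifting x by w splits \<open>B y x\<close> into
  \<open>B y w\<close> and \<open>B y (x - w)\<close>: the inner integral is then the completed
  square, and the outer one is the transform of \<open>\<Phi>\<close>.\<close>

lemma transform_convolution:
  assumes \<Phi>: "\<Phi> \<in> step_functions"
  shows "transform (convolution \<mu> \<Phi> \<phi>) y = G * transform \<Phi> y * \<phi>i y"
proof -
  let ?c = "convolution \<mu> \<Phi> \<phi>"
  obtain \<epsilon>1 \<epsilon>2 \<epsilon>3 \<epsilon>4 where e: "\<epsilon>1 > 0" "\<And>\<epsilon> x. \<epsilon>1 \<le> \<epsilon> \<Longrightarrow> x \<notin> L \<epsilon> \<Longrightarrow> \<Phi> x = 0"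
    "\<epsilon>2 > 0" "\<And>\<epsilon> x. \<epsilon>2 \<le> \<epsilon> \<Longrightarrow> x \<notin> L \<epsilon> \<Longrightarrow> ?c x = 0"
    "\<epsilon>3 > 0" "K0 \<subseteq> L \<epsilon>3" "\<epsilon>4 > 0" "y \<in> L \<epsilon>4"
    using step_support[OF \<Phi>] step_support[OF step_convolution[OF \<Phi>]] K0(1) L_exhaust[of y]
    unfolding lattice_def by metis
  \<comment> \<open>One lattice is to contain the supports of \<open>\<Phi>\<close> and of the
    convolution, the lattice \<open>K0\<close>, and the point \<open>y\<close>.\<close>
  define \<epsilon> where "\<epsilon> = max (max \<epsilon>1 \<epsilon>2) (max \<epsilon>3 \<epsilon>4)"
  define K where "K = L \<epsilon>"
  have le: "\<epsilon>1 \<le> \<epsilon>" "\<epsilon>2 \<le> \<epsilon>" "\<epsilon>3 \<le> \<epsilon>" "\<epsilon>4 \<le> \<epsilon>" "\<epsilon> > 0"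
    using e(1) by (auto simp: \<epsilon>_def)
  have K: "lattice K" "K0 \<subseteq> K" and y: "y \<in> K"
    using lattice_L[OF le(5)] L_mono[OF e(5) le(3)] L_mono[OF e(7) le(4)] e(6,8) by (auto simp: K_def)
  have \<Phi>0: "\<Phi> x = 0" and c0: "?c x = 0" if "x \<notin> K" for x
    using e(2)[OF le(1)] e(4)[OF le(2)] that by (auto simp: K_def)
  have sub: "x - w \<in> L \<epsilon>" if "x \<in> K" "w \<in> K" for x w
    using add_subgroup_diff[OF subgroup_L[OF le(5)]] that by (simp add: K_def)
  obtain \<delta>1 where d1: "\<delta>1 > 0" "\<And>x z. x \<in> L \<epsilon> \<Longrightarrow> z \<in> L \<delta>1 \<Longrightarrow> B x z = 1"
    "\<And>x z. x \<in> L \<epsilon> \<Longrightarrow> z \<in> L \<delta>1 \<Longrightarrow> \<phi> (x + z) = \<phi> x"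
    using phi_locally_constant[OF le(5)] by metis
  obtain \<delta>2 where d2: "\<delta>2 > 0" "\<And>x z. z \<in> L \<delta>2 \<Longrightarrow> \<Phi> (x + z) = \<Phi> x"
    using step_functionsE[OF \<Phi>] by metis
  define \<delta> where "\<delta> = min \<delta>1 \<delta>2"
  have d: "\<delta> > 0" "L \<delta> \<subseteq> L \<delta>1" "L \<delta> \<subseteq> L \<delta>2"
    using d1(1) d2(1) L_subset_min[OF d1(1) d2(1)] by (auto simp: \<delta>_def)
  have inv1: "\<Phi> w * \<phi> (x + z - w) * B y (x + z) = \<Phi> w * \<phi> (x - w) * B y x"
    if "x \<in> K" "w \<in> K" "z \<in> L \<delta>" for x w z
  proof -
    have "\<phi> (x - w + z) = \<phi> (x - w)" using d1(3) sub that d(2) by blast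
    moreover have "B y (x + z) = B y x" using d1(2)[of y z] y that(3) d(2) by (auto simp: B_add_right K_def)
    ultimately show ?thesis by (simp add: algebra_simps)
  qed
  have inv2: "\<Phi> (w + z) * \<phi> (x - (w + z)) * B y x = \<Phi> w * \<phi> (x - w) * B y x"
    if "x \<in> K" "w \<in> K" "z \<in> L \<delta>" for x w z
  proof -
    have "- z \<in> L \<delta>1" using that(3) d(2) add_subgroup_minus[OF subgroup_L[OF d1(1)]] by blast
    then have "\<phi> (x - w + - z) = \<phi> (x - w)" using d1(3) sub that by blast
    then show ?thesis using d2(2)[of z w] that(3) d(3) by (auto simp: algebra_simps)
  qed
  have c_eq: "?c x = integral_over \<mu> K (\<lambda>w. \<Phi> w * \<phi> (x - w))" for x
    unfolding convolution_def by (rule integral_step[symmetric]) (simp add: \<Phi>0)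
  have uw0: "unif K (\<lambda>w. \<Phi> w * \<phi> (x - w))" if "x \<in> K" for x
  proof -
    \<comment> \<open>Invariance without the factor \<open>B y x\<close> follows from
      \<open>inv2\<close> by cancelling it.\<close>
    have "B y x \<noteq> 0" using B_minus_mult[of y x] by auto
    then have "\<Phi> (w + z) * \<phi> (x - (w + z)) = \<Phi> w * \<phi> (x - w)" if "w \<in> K" "z \<in> L \<delta>" for w z
      using inv2[OF \<open>x \<in> K\<close> that] by auto
    then show ?thesis unfolding unif_def using d(1) by blast
  qed
  have "transform ?c y = integral_over \<mu> K (\<lambda>x. ?c x * B y x)"
    unfolding transform_def by (rule integral_step[symmetric]) (simp add: c0)
  also have "\<dots> = integral_over \<mu> K (\<lambda>x. integral_over \<mu> K (\<lambda>w. \<Phi> w * \<phi> (x - w) * B y x))"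
  proof (rule integral_cong)
    fix x assume x: "x \<in> K"
    show "?c x * B y x = integral_over \<mu> K (\<lambda>w. \<Phi> w * \<phi> (x - w) * B y x)"
      using integral_scale[OF K(1) uw0[OF x], of "B y x"] by (simp add: c_eq mult.commute)
  qed
  also have "\<dots> = integral_over \<mu> K (\<lambda>w. integral_over \<mu> K (\<lambda>x. \<Phi> w * \<phi> (x - w) * B y x))"
    by (rule integral_swap[OF K(1,1) d(1)]) (use inv1 inv2 in auto)
  also have "\<dots> = integral_over \<mu> K (\<lambda>w. G * \<phi>i y * (\<Phi> w * B y w))"
  proof (rule integral_cong)
    fix w assume w: "w \<in> K"
    have u: "unif K (\<lambda>x. \<Phi> w * B y w * (\<phi> x * B y x))"
      by (intro unif_mult unif_const unif_phi K(1))
    have "- w \<in> K" using w add_subgroup_minus[OF lattice_subgroup[OF K(1)]] by blast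
    then have "integral_over \<mu> K (\<lambda>x. \<Phi> w * B y w * (\<phi> x * B y x)) =
        integral_over \<mu> K (\<lambda>x. \<Phi> w * B y w * (\<phi> (x - w) * B y (x - w)))"
      using integral_translate[OF K(1) u, of "- w"] by simp
    also have "B y w * B y (x - w) = B y x" for x
      using B_add_right[of y w "x - w"] by simp
    then have "(\<lambda>x. \<Phi> w * B y w * (\<phi> (x - w) * B y (x - w))) = (\<lambda>x. \<Phi> w * \<phi> (x - w) * B y x)"
      by (simp add: fun_eq_iff mult.assoc mult.left_commute)
    finally show "integral_over \<mu> K (\<lambda>x. \<Phi> w * \<phi> (x - w) * B y x) = G * \<phi>i y * (\<Phi> w * B y w)"
      using integral_scale[OF K(1) unif_mult[OF unif_phi(1)[OF K(1)] unif_phi(3)[OF K(1)]], of "\<Phi> w * B y w" y]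
        integral_phi_B[OF K y] by (simp add: mult.commute)
  qed
  also have "\<dots> = G * \<phi>i y * integral_over \<mu> K (\<lambda>w. \<Phi> w * B y w)"
    by (intro integral_scale unif_step step_mult_B \<Phi> K(1))
  also have "integral_over \<mu> K (\<lambda>w. \<Phi> w * B y w) = transform \<Phi> y"
    unfolding transform_def by (rule integral_step) (simp add: \<Phi>0)
  finally show ?thesis by (simp add: ac_simps)
qed

end

end

section \<open>Local fields and their vector spaces\<close>

context nonarch_local_field
begin

lemma v_zero: "v 0 = 0"
  by (simp add: v_eq_0_iff)

lemma v_pos: "x \<noteq> 0 \<Longrightarrow> 0 < v x"
  using v_nonneg[of x] v_eq_0_iff[of x] by linarith

lemma v_one: "v 1 = 1"
  using v_mult[of 1 1] v_pos[of 1] by simp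

lemma v_minus: "v (- x) = v x"
proof -
  have "v (- 1) * v (- 1) = 1" using v_mult[of "- 1" "- 1"] v_one by simp
  then have "(v (- 1) - 1) * (v (- 1) + 1) = 0" by (simp add: algebra_simps)
  then have "v (- 1) = 1" using v_nonneg[of "- 1"] by (auto simp: add_eq_0_iff)
  then show ?thesis using v_mult[of "- 1" x] by simp
qed

lemma v_diff: "v (x - y) \<le> max (v x) (v y)"
  using v_ultrametric[of x "- y"] by (simp add: v_minus)

lemma v_inverse: "v (inverse x) = inverse (v x)"
proof (cases "x = 0")
  case False
  then show ?thesis using v_mult[of x "inverse x"] v_pos[of x] by (simp add: v_one field_simps)
qed (simp add: v_zero)

lemma v_add_le: "v x \<le> r \<Longrightarrow> v y \<le> r \<Longrightarrow> v (x + y) \<le> r"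
  using v_ultrametric[of x y] by linarith

lemma v_sum_le:
  assumes "0 \<le> r" "\<And>i. i \<in> I \<Longrightarrow> v (g i) \<le> r"
  shows "v (sum g I) \<le> r"
  using assms(2)
proof (induction I rule: infinite_finite_induct)
  case (insert i I)
  then show ?case by (simp add: v_add_le)
qed (use assms(1) in \<open>auto simp: v_zero\<close>)

lemma v_diff_le: "v x \<le> r \<Longrightarrow> v y \<le> r \<Longrightarrow> v (x - y) \<le> r"
  using v_diff[of x y] by linarith

lemma open_v_le:
  assumes "r > 0"
  shows "open {x. v (x - c) \<le> r}"
  unfolding open_iff_v
proof (intro ballI exI[of _ r] conjI allI impI)
  fix x y assume "x \<in> {x. v (x - c) \<le> r}" "v (y - x) < r"
  then show "y \<in> {x. v (x - c) \<le> r}" using v_add_le[of "x - c" r "y - x"] by simp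
qed (use assms in auto)

lemma closed_v_le:
  assumes "r > 0"
  shows "closed {x. v x \<le> r}"
  unfolding closed_def open_iff_v
proof (intro ballI exI[of _ r] conjI allI impI)
  fix x y assume "x \<in> - {x. v x \<le> r}" "v (y - x) < r"
  then show "y \<in> - {x. v x \<le> r}" using v_diff_le[of y r "y - x"] by auto
qed (use assms in auto)

text \<open>Without small non-zero elements, balls would be single points and every set would be
  open.\<close>

lemma exists_small:
  assumes "e > 0"
  obtains t where "t \<noteq> 0" "v t < e"
proof -
  obtain S :: "'f set" where "\<not> open S" using non_discrete by blast
  then obtain x where "\<forall>d>0. \<exists>y. v (y - x) < d \<and> y \<notin> S" "x \<in> S"
    unfolding open_iff_v by blast
  then obtain y where "v (y - x) < e" "y \<notin> S" using assms by blast
  then show ?thesis using that[of "y - x"] \<open>x \<in> S\<close> by auto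
qed

text \<open>Local compactness yields one compact ball around 0; multiplication by the inverse of a
  small enough \<open>t\<close> spreads it over the ball of radius \<open>r\<close>.\<close>

lemma compact_v_le:
  assumes "r > 0"
  shows "compact {x. v x \<le> r}"
proof -
  obtain U K :: "'f set" where UK: "open U" "compact K" "0 \<in> U" "U \<subseteq> K"
    using locally_compact by (simp add: locally_compact_space_def) metis
  obtain e where e: "e > 0" "\<And>y. v y < e \<Longrightarrow> y \<in> U"
    using UK(1,3) unfolding open_iff_v by (metis diff_zero)
  have "{x. v x \<le> e / 2} \<subseteq> K" using e UK(4) by force
  then have small: "compact {x. v x \<le> e / 2}"
    using closed_Int_compact[OF closed_v_le[of "e / 2"] UK(2)] e(1) by (simp add: Int_absorb2)
  obtain t where t: "t \<noteq> 0" "v t < e / 2 / r"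
    using exists_small[of "e / 2 / r"] e(1) assms by auto
  have "continuous_on UNIV ((*) (inverse t))"
  proof (rule continuous_on_open_vimage[THEN iffD2, rule_format])
    show "open (UNIV :: 'f set)" by simp
    fix W :: "'f set" assume W: "open W"
    have "open ((*) (inverse t) -` W)"
      unfolding open_iff_v
    proof
      fix x assume "x \<in> (*) (inverse t) -` W"
      then obtain d where d: "d > 0" "\<And>y. v (y - inverse t * x) < d \<Longrightarrow> y \<in> W"
        using W unfolding open_iff_v by blast
      have "inverse t * y \<in> W" if "v (y - x) < d * v t" for y
      proof (rule d(2))
        have "v (inverse t * y - inverse t * x) = v (y - x) / v t"
          unfolding right_diff_distrib[symmetric] v_mult v_inverse by (simp add: divide_inverse mult.commute)
        then show "v (inverse t * y - inverse t * x) < d"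
          using that v_pos[OF t(1)] by (simp add: divide_less_eq)
      qed
      then show "\<exists>e>0. \<forall>y. v (y - x) < e \<longrightarrow> y \<in> (*) (inverse t) -` W"
        using d(1) v_pos[OF t(1)] by (intro exI[of _ "d * v t"]) auto
    qed
    then show "open ((*) (inverse t) -` W \<inter> UNIV)" by simp
  qed
  then have big: "compact ((*) (inverse t) ` {x. v x \<le> e / 2})"
    using compact_continuous_image[OF _ small] continuous_on_subset by blast
  have "{x. v x \<le> r} \<subseteq> (*) (inverse t) ` {x. v x \<le> e / 2}"
  proof
    fix x assume x: "x \<in> {x. v x \<le> r}"
    have "v (t * x) \<le> e / 2 / r * r"
      unfolding v_mult using x t(2) v_nonneg e(1) assms by (intro mult_mono) auto
    also have "\<dots> = e / 2" using assms by simp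
    finally have "t * x \<in> {x. v x \<le> e / 2}" by simp
    moreover have "x = inverse t * (t * x)" using t(1) by simp
    ultimately show "x \<in> (*) (inverse t) ` {x. v x \<le> e / 2}" by (rule rev_image_eqI)
  qed
  then show ?thesis
    using closed_Int_compact[OF closed_v_le[OF assms] big] by (simp add: Int_absorb2)
qed

lemma finite_v_cover:
  assumes "\<delta> > 0" "\<epsilon> > 0"
  obtains D where "finite D" "\<And>x. v x \<le> \<epsilon> \<Longrightarrow> \<exists>d\<in>D. v (x - d) \<le> \<delta>"
proof -
  have "{x. v x \<le> \<epsilon>} \<subseteq> (\<Union>d\<in>{x. v x \<le> \<epsilon>}. {x. v (x - d) \<le> \<delta>})"
    using assms(1) by (auto simp: v_zero)
  then obtain D where "finite D" "{x. v x \<le> \<epsilon>} \<subseteq> (\<Union>d\<in>D. {x. v (x - d) \<le> \<delta>})"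
    using compactE_image[OF compact_v_le[OF assms(2)], of "{x. v x \<le> \<epsilon>}" "\<lambda>d. {x. v (x - d) \<le> \<delta>}"]
      open_v_le[OF assms(1)] by metis
  then show ?thesis using that by blast
qed

end

section \<open>The residue field\<close>

context nonarch_local_field
begin

lemma v_of_nat_le: "v (of_nat n) \<le> 1"
  by (induction n) (simp_all add: v_zero v_add_le v_one)

lemma v_mult_less_one:
  assumes "v x \<le> 1" "v y < 1"
  shows "v (x * y) < 1"
  unfolding v_mult using mult_right_mono[OF assms(1) v_nonneg[of y]] assms(2) by simp

text \<open>The natural numbers in the maximal ideal are closed under remainders, so their least
  positive element divides all of them and equals the \<open>Gcd\<close>.\<close>

lemma residue_char_in_maximal_ideal:
  assumes "residue_char v \<noteq> 0"
  shows "of_nat (residue_char v) \<in> maximal_ideal v"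
proof -
  define N where "N = {n. of_nat n \<in> maximal_ideal v}"
  have "\<exists>n\<in>N. n > 0" using assms by (auto simp: residue_char_def N_def[symmetric])
  then obtain n where n: "n > 0 \<and> n \<in> N" by blast
  define d where "d = (LEAST d. d > 0 \<and> d \<in> N)"
  have d: "d > 0" "d \<in> N" using LeastI[of "\<lambda>d. d > 0 \<and> d \<in> N", OF n] by (auto simp: d_def)
  have min: "e = 0" if "e < d" "e \<in> N" for e
    using not_less_Least[of e "\<lambda>d. d > 0 \<and> d \<in> N"] that by (auto simp: d_def)
  have "d dvd m" if m: "m \<in> N" for m
  proof -
    have "(of_nat m :: 'f) = of_nat (m div d) * of_nat d + of_nat (m mod d)"
      unfolding of_nat_mult[symmetric] of_nat_add[symmetric] by simp
    then have eq: "(of_nat (m mod d) :: 'f) = of_nat m - of_nat (m div d) * of_nat d" by simp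
    have "v (of_nat (m div d) * of_nat d) < 1"
      using v_mult_less_one[OF v_of_nat_le] d(2) by (simp add: N_def maximal_ideal_def)
    then have "v (of_nat (m mod d)) < 1"
      unfolding eq using v_diff[of "of_nat m" "of_nat (m div d) * of_nat d"] m
      by (auto simp: N_def maximal_ideal_def)
    then have "m mod d = 0" using min[of "m mod d"] d(1) by (simp add: N_def maximal_ideal_def)
    then show ?thesis by blast
  qed
  then have "d dvd Gcd N" by (rule Gcd_greatest)
  moreover have "Gcd N dvd d" using d(2) by (rule Gcd_dvd)
  ultimately have "Gcd N = d" by (simp add: dvd_antisym)
  then show ?thesis using d(2) by (simp add: residue_char_def N_def)
qed

text \<open>\<open>q\<close> is the index of the maximal ideal in the valuation ring, and
  \<open>p\<close> maps the valuation ring into that ideal.\<close>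

lemma card_residue_field_unit:
  assumes p: "of_nat (residue_char v) dvd (1::'r::idom)"
  shows "of_nat (card (residue_field v)) dvd (1::'r)"
proof -
  have p0: "residue_char v \<noteq> 0"
  proof
    assume "residue_char v = 0"
    then show False using p by simp
  qed
  have M: "add_subgroup (maximal_ideal v)"
    by (intro add_subgroupI)
      (auto simp: maximal_ideal_def v_zero intro: le_less_trans[OF v_diff])
  have O: "add_subgroup (valuation_ring v)"
    by (intro add_subgroupI) (simp_all add: valuation_ring_def v_zero v_diff_le)
  have MO: "maximal_ideal v \<subseteq> valuation_ring v" by (auto simp: maximal_ideal_def valuation_ring_def)
  have pM: "of_nat (residue_char v) * x \<in> maximal_ideal v" if "x \<in> valuation_ring v" for x
    using residue_char_in_maximal_ideal[OF p0] that v_mult_less_one[of x "of_nat (residue_char v)"]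
    by (simp add: maximal_ideal_def valuation_ring_def mult.commute)
  \<comment> \<open>Any radius below 1 will do: the differences then lie in the maximal
    ideal.\<close>
  obtain D where D: "finite D" "\<And>x. v x \<le> 1 \<Longrightarrow> \<exists>d\<in>D. v (x - d) \<le> 1 / 2"
    using finite_v_cover[of "1 / 2" 1] by auto
  have cov: "\<exists>d\<in>D. x - d \<in> maximal_ideal v" if "x \<in> valuation_ring v" for x
    using D(2)[of x] that by (force simp: valuation_ring_def maximal_ideal_def)
  obtain C where C: "transversal (valuation_ring v) (maximal_ideal v) C" "of_nat (card C) dvd (1::'r)"
    using index_unit_exponent[OF M O MO _ pM p D(1) cov] p0 by blast
  then show ?thesis
    using card_quotient_eq_transversal[OF M C(1)] by (simp add: residue_field_def)
qed

end

section \<open>Topology of a finite-dimensional space in coordinates\<close>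

locale nonarch_vector_space = nonarch_local_field v + finite_dimensional_vector_space smul Basis
  for v :: "'f::{field,topological_space} \<Rightarrow> real" and smul :: "'f \<Rightarrow> 'x::ab_group_add \<Rightarrow> 'x"
    and Basis :: "'x set"
begin

abbreviation T :: "'x topology" where "T \<equiv> space_top smul"

definition coord :: "'x \<Rightarrow> 'x \<Rightarrow> 'f" where
  "coord b x = representation Basis x b"

definition L :: "real \<Rightarrow> 'x set" where
  "L \<epsilon> = {x. \<forall>b\<in>Basis. v (coord b x) \<le> \<epsilon>}"

lemma coord_add: "coord b (x + y) = coord b x + coord b y"
  unfolding coord_def using representation_add[of Basis y x] independent_Basis span_Basis by simp

lemma coord_diff: "coord b (x - y) = coord b x - coord b y"
  unfolding coord_def using representation_diff[of Basis y x] independent_Basis span_Basis by simp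

lemma coord_scale: "coord b (smul c x) = c * coord b x"
  unfolding coord_def using representation_scale[of Basis x c] independent_Basis span_Basis by simp

lemma coord_basis: "b \<in> Basis \<Longrightarrow> coord c b = (if c = b then 1 else 0)"
  unfolding coord_def using representation_basis[OF independent_Basis, of b] by simp

lemma sum_coord: "(\<Sum>b\<in>Basis. smul (coord b x) b) = x"
  unfolding coord_def
  by (rule sum_representation_eq) (use independent_Basis span_Basis finite_Basis in auto)

lemma dual_iff: "l \<in> dual smul \<longleftrightarrow> (\<forall>x y. l (x + y) = l x + l y) \<and> (\<forall>c x. l (smul c x) = c * l x)"
proof -
  have "vector_space ((*) :: 'f \<Rightarrow> 'f \<Rightarrow> 'f)"
    by unfold_locales (simp_all add: algebra_simps)
  then show ?thesis
    unfolding dual_def Vector_Spaces.linear_iff using vector_space_axioms by simp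
qed

lemma dual_add: "l \<in> dual smul \<Longrightarrow> l (x + y) = l x + l y"
  and dual_scale: "l \<in> dual smul \<Longrightarrow> l (smul c x) = c * l x"
  by (simp_all add: dual_iff)

lemma dual_zero: "l \<in> dual smul \<Longrightarrow> l 0 = 0"
  using dual_scale[of l 0 0] by simp

lemma dual_sum: "l \<in> dual smul \<Longrightarrow> l (\<Sum>i\<in>I. g i) = (\<Sum>i\<in>I. l (g i))"
  by (induction I rule: infinite_finite_induct) (simp_all add: dual_zero dual_add)

lemma dual_coord: "l \<in> dual smul \<Longrightarrow> l x = (\<Sum>b\<in>Basis. coord b x * l b)"
  using dual_sum[of l "\<lambda>b. smul (coord b x) b" Basis] by (simp add: sum_coord dual_scale)

lemma coord_in_dual: "coord b \<in> dual smul"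
  by (simp add: dual_iff coord_add coord_scale)

lemma dual_bound:
  assumes "l \<in> dual smul"
  obtains M where "M > 0" "\<And>b. b \<in> Basis \<Longrightarrow> v (l b) \<le> M"
    "\<And>\<epsilon> x. \<epsilon> > 0 \<Longrightarrow> x \<in> L \<epsilon> \<Longrightarrow> v (l x) \<le> \<epsilon> * M"
proof -
  \<comment> \<open>The summand 1 keeps the bound positive when \<open>l\<close> is zero or the
    basis is empty.\<close>
  define M where "M = 1 + (\<Sum>b\<in>Basis. v (l b))"
  have M: "M > 0" using sum_nonneg[of Basis "\<lambda>b. v (l b)"] v_nonneg unfolding M_def by force
  have b: "v (l b) \<le> M" if "b \<in> Basis" for b
    using member_le_sum[of b Basis "\<lambda>b. v (l b)"] that v_nonneg finite_Basis unfolding M_def by force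
  have "v (l x) \<le> \<epsilon> * M" if "\<epsilon> > 0" "x \<in> L \<epsilon>" for \<epsilon> x
    unfolding dual_coord[OF assms, of x]
    by (rule v_sum_le) (use that b v_nonneg M in \<open>auto simp: v_mult L_def intro!: mult_mono\<close>)
  then show ?thesis using that M b by blast
qed

lemma add_subgroup_L: "\<epsilon> > 0 \<Longrightarrow> add_subgroup (L \<epsilon>)"
  using dual_zero[OF coord_in_dual]
  by (intro add_subgroupI) (simp_all add: L_def coord_diff v_diff_le v_zero)

lemma L_mono': "\<delta> \<le> \<epsilon> \<Longrightarrow> L \<delta> \<subseteq> L \<epsilon>"
  unfolding L_def by force

lemma in_L_exists: "\<exists>\<epsilon>>0. x \<in> L \<epsilon>"
proof -
  have "v (coord b x) \<le> 1 + (\<Sum>b\<in>Basis. v (coord b x))" if "b \<in> Basis" for b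
    using member_le_sum[of b Basis "\<lambda>b. v (coord b x)"] that v_nonneg finite_Basis by force
  moreover have "1 + (\<Sum>b\<in>Basis. v (coord b x)) > 0"
    using sum_nonneg[of Basis "\<lambda>b. v (coord b x)"] v_nonneg by force
  ultimately show ?thesis unfolding L_def by blast
qed

lemma topspace_T: "topspace T = UNIV"
proof -
  have "(\<lambda>_. 0) \<in> dual smul" by (simp add: dual_iff)
  then have "(\<lambda>_. 0) -` UNIV \<in> {l -` U |l U. l \<in> dual smul \<and> open U}" by blast
  then show ?thesis unfolding space_top_def topology_generated_by_topspace by auto
qed

text \<open>The initial topology is the coordinate topology: a functional is a bounded combination
  of coordinates, and coordinates are functionals.\<close>

lemma openin_T_iff: "openin T U \<longleftrightarrow> (\<forall>x\<in>U. \<exists>\<epsilon>>0. \<forall>z\<in>L \<epsilon>. x + z \<in> U)"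
proof
  assume "openin T U"
  then have "generate_topology_on {l -` U |l U. l \<in> dual smul \<and> open U} U"
    by (simp add: space_top_def openin_topology_generated_by_iff)
  then show "\<forall>x\<in>U. \<exists>\<epsilon>>0. \<forall>z\<in>L \<epsilon>. x + z \<in> U"
  proof (induction rule: generate_topology_on.induct)
    case (Int S S')
    show ?case
    proof
      fix x assume x: "x \<in> S \<inter> S'"
      obtain \<epsilon> \<epsilon>' where "\<epsilon> > 0" "\<forall>z\<in>L \<epsilon>. x + z \<in> S" "\<epsilon>' > 0" "\<forall>z\<in>L \<epsilon>'. x + z \<in> S'"
        using Int x by blast
      then show "\<exists>\<epsilon>>0. \<forall>z\<in>L \<epsilon>. x + z \<in> S \<inter> S'"
        using L_mono'[of "min \<epsilon> \<epsilon>'"] by (intro exI[of _ "min \<epsilon> \<epsilon>'"]) (auto simp: subset_iff)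
    qed
  next
    case (UN K)
    then show ?case by (meson UnionE UnionI)
  next
    case (Basis S)
    then obtain l W where l: "l \<in> dual smul" "open W" "S = l -` W" by blast
    obtain M where M: "M > 0" "\<And>\<epsilon> x. \<epsilon> > 0 \<Longrightarrow> x \<in> L \<epsilon> \<Longrightarrow> v (l x) \<le> \<epsilon> * M"
      using dual_bound[OF l(1)] by metis
    show ?case
    proof
      fix x assume "x \<in> S"
      then obtain e where e: "e > 0" "\<And>y. v (y - l x) < e \<Longrightarrow> y \<in> W"
        using l(2,3) unfolding open_iff_v by blast
      \<comment> \<open>Halving \<open>e\<close> turns the bound with \<open>\<le>\<close> into the
        strict inequality of \<open>open_iff_v\<close>.\<close>
      have "x + z \<in> S" if "z \<in> L (e / 2 / M)" for z
      proof -
        have "v (l z) \<le> e / 2 / M * M" using M(2)[OF _ that] e(1) M(1) by simp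
        then have "v (l z) < e" using M(1) e(1) by simp
        then show ?thesis using l e(2)[of "l x + l z"] by (simp add: dual_add)
      qed
      then show "\<exists>\<epsilon>>0. \<forall>z\<in>L \<epsilon>. x + z \<in> S"
        using e(1) M(1) by (intro exI[of _ "e / 2 / M"]) auto
    qed
  qed auto
next
  assume U: "\<forall>x\<in>U. \<exists>\<epsilon>>0. \<forall>z\<in>L \<epsilon>. x + z \<in> U"
  show "openin T U"
    unfolding openin_subopen[of T U]
  proof
    fix x assume "x \<in> U"
    then obtain \<epsilon> where e: "\<epsilon> > 0" "\<forall>z\<in>L \<epsilon>. x + z \<in> U" using U by blast
    define N where "N b = coord b -` {y. v (y - coord b x) \<le> \<epsilon>}" for b
    have N: "openin T (N b)" for b
      unfolding N_def space_top_def
      by (rule topology_generated_by_Basis) (use coord_in_dual open_v_le[OF e(1)] in blast)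
    \<comment> \<open>Inserting \<open>UNIV\<close> keeps the family non-empty when X is
      zero.\<close>
    have "openin T (\<Inter> (insert UNIV (N ` Basis)))"
      by (rule openin_Inter) (use N finite_Basis openin_topspace[of T] in \<open>auto simp: topspace_T\<close>)
    moreover have "\<Inter> (insert UNIV (N ` Basis)) \<subseteq> U"
    proof
      fix y assume "y \<in> \<Inter> (insert UNIV (N ` Basis))"
      then have "y - x \<in> L \<epsilon>" by (auto simp: N_def L_def coord_diff)
      then show "y \<in> U" using e(2) by force
    qed
    moreover have "x \<in> \<Inter> (insert UNIV (N ` Basis))" using e(1) by (auto simp: N_def v_zero)
    ultimately show "\<exists>W. openin T W \<and> x \<in> W \<and> W \<subseteq> U" by blast
  qed
qed

lemma openin_coset: "\<epsilon> > 0 \<Longrightarrow> openin T {y. y - x \<in> L \<epsilon>}"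
  unfolding openin_T_iff
proof
  fix y assume e: "\<epsilon> > 0" and y: "y \<in> {y. y - x \<in> L \<epsilon>}"
  have "y + z - x \<in> L \<epsilon>" if "z \<in> L \<epsilon>" for z
    using add_subgroup_add[OF add_subgroup_L[OF e], of "y - x" z] y that by (simp add: algebra_simps)
  then show "\<exists>\<epsilon>'>0. \<forall>z\<in>L \<epsilon>'. y + z \<in> {y. y - x \<in> L \<epsilon>}" using e by auto
qed

lemma openin_L: "\<epsilon> > 0 \<Longrightarrow> openin T (L \<epsilon>)"
  using openin_coset[of \<epsilon> 0] by simp

lemma closedin_subgroup:
  assumes K: "add_subgroup K" "\<delta> > 0" "L \<delta> \<subseteq> K"
  shows "closedin T K"
  unfolding closedin_def topspace_T openin_T_iff
proof (intro conjI ballI)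
  fix x assume "x \<in> UNIV - K"
  then have "\<forall>z\<in>L \<delta>. x + z \<in> UNIV - K"
    using add_subgroup_add_iff[OF K(1)] K(3) by auto
  then show "\<exists>\<epsilon>>0. \<forall>z\<in>L \<epsilon>. x + z \<in> UNIV - K" using K(2) by blast
qed simp

text \<open>\<open>L \<epsilon>\<close> is the continuous image of a product of compact balls of the
  field under the map taking coordinates to vectors.\<close>

lemma compactin_L:
  assumes "\<epsilon> > 0"
  shows "compactin T (L \<epsilon>)"
proof -
  define P where "P = product_topology (\<lambda>_. euclidean :: 'f topology) Basis"
  define g where "g c = (\<Sum>b\<in>Basis. smul (c b) b)" for c
  have coord_g: "coord b (g c) = c b" if "b \<in> Basis" for b c
  proof -
    have "coord b (g c) = (\<Sum>b'\<in>Basis. c b' * coord b b')"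
      unfolding g_def dual_sum[OF coord_in_dual] by (simp add: coord_scale)
    also have "\<dots> = (\<Sum>b'\<in>Basis. if b = b' then c b' else 0)"
      by (rule sum.cong) (simp_all add: coord_basis)
    finally show ?thesis using that finite_Basis by simp
  qed
  have cont: "continuous_map P T g"
    unfolding continuous_map_def
  proof (intro conjI allI impI)
    show "g \<in> topspace P \<rightarrow> topspace T" by (simp add: topspace_T)
    fix U assume U: "openin T U"
    show "openin P {c \<in> topspace P. g c \<in> U}"
      unfolding P_def openin_product_topology_alt
    proof
      fix c assume "c \<in> {c \<in> topspace (product_topology (\<lambda>_. euclidean :: 'f topology) Basis). g c \<in> U}"
      then have c: "c \<in> extensional Basis" "g c \<in> U" by (auto simp: PiE_def)
      obtain \<delta> where d: "\<delta> > 0" "\<And>z. z \<in> L \<delta> \<Longrightarrow> g c + z \<in> U"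
        using U c(2) unfolding openin_T_iff by blast
      define N where "N b = {y. v (y - c b) \<le> \<delta>}" for b
      have "Pi\<^sub>E Basis N \<subseteq> {c \<in> topspace (product_topology (\<lambda>_. euclidean :: 'f topology) Basis). g c \<in> U}"
      proof
        fix c' assume c': "c' \<in> Pi\<^sub>E Basis N"
        then have "g c' - g c \<in> L \<delta>"
          by (auto simp: L_def coord_diff coord_g N_def dest: PiE_mem)
        then have "g c + (g c' - g c) \<in> U" by (rule d(2))
        then show "c' \<in> {c \<in> topspace (product_topology (\<lambda>_. euclidean :: 'f topology) Basis). g c \<in> U}"
          using c' by (simp add: PiE_def)
      qed
      moreover have "c \<in> Pi\<^sub>E Basis N" using c(1) d(1) by (simp add: PiE_def N_def v_zero)
      moreover have "\<forall>b\<in>Basis. openin euclidean (N b)" using open_v_le[OF d(1)] by (simp add: N_def)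
      moreover have "finite {b \<in> Basis. N b \<noteq> topspace (euclidean :: 'f topology)}"
        using finite_Basis by simp
      ultimately show "\<exists>U'. finite {i \<in> Basis. U' i \<noteq> topspace (euclidean :: 'f topology)} \<and>
          (\<forall>i\<in>Basis. openin euclidean (U' i)) \<and> c \<in> Pi\<^sub>E Basis U' \<and>
          Pi\<^sub>E Basis U' \<subseteq> {c \<in> topspace (product_topology (\<lambda>_. euclidean :: 'f topology) Basis). g c \<in> U}"
        by blast
    qed
  qed
  have "compactin P (Pi\<^sub>E Basis (\<lambda>_. {x. v x \<le> \<epsilon>}))"
    unfolding P_def compactin_PiE using compact_v_le[OF assms] by simp
  then have "compactin T (g ` Pi\<^sub>E Basis (\<lambda>_. {x. v x \<le> \<epsilon>}))"
    by (rule image_compactin[OF _ cont])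
  also have "g ` Pi\<^sub>E Basis (\<lambda>_. {x. v x \<le> \<epsilon>}) = L \<epsilon>"
  proof (intro equalityI subsetI)
    fix x assume "x \<in> g ` Pi\<^sub>E Basis (\<lambda>_. {x. v x \<le> \<epsilon>})"
    then show "x \<in> L \<epsilon>" by (auto simp: L_def coord_g dest: PiE_mem)
  next
    fix x assume "x \<in> L \<epsilon>"
    then have "restrict (\<lambda>b. coord b x) Basis \<in> Pi\<^sub>E Basis (\<lambda>_. {x. v x \<le> \<epsilon>})"
      by (auto simp: L_def)
    moreover have "g (restrict (\<lambda>b. coord b x) Basis) = x"
      using sum_coord[of x] by (simp add: g_def)
    ultimately show "x \<in> g ` Pi\<^sub>E Basis (\<lambda>_. {x. v x \<le> \<epsilon>})" by (metis imageI)
  qed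
  finally show ?thesis .
qed

sublocale filtered_group L
proof
  fix \<delta> \<epsilon> :: real assume *: "0 < \<delta>" "0 < \<epsilon>"
  define W where "W x = {y. y - x \<in> L \<delta>}" for x
  have "x \<in> W x" for x
    using add_subgroup_zero[OF add_subgroup_L[OF *(1)]] by (simp add: W_def)
  then have "L \<epsilon> \<subseteq> \<Union> (range W)" by blast
  moreover have "\<And>U. U \<in> range W \<Longrightarrow> openin T U" using openin_coset[OF *(1)] by (auto simp: W_def)
  ultimately obtain F where F: "finite F" "F \<subseteq> range W" "L \<epsilon> \<subseteq> \<Union> F"
    using compactinD[OF compactin_L[OF *(2)]] by metis
  obtain D where "finite D" "F = W ` D" using finite_subset_image[OF F(1,2)] by blast
  then show "\<exists>D. finite D \<and> (\<forall>x\<in>L \<epsilon>. \<exists>d\<in>D. x - d \<in> L \<delta>)"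
    using F(3) by (intro exI[of _ D]) (auto simp: W_def)
qed (use add_subgroup_L L_mono' in_L_exists in auto)

lemma compact_subset_L:
  assumes "compactin T S"
  obtains \<epsilon> where "\<epsilon> > 0" "S \<subseteq> L \<epsilon>"
proof -
  have "\<And>U. U \<in> L ` {0<..} \<Longrightarrow> openin T U" using openin_L by auto
  moreover have "S \<subseteq> \<Union> (L ` {0<..})"
  proof
    fix x
    show "x \<in> \<Union> (L ` {0<..})" using L_exhaust[of x] by auto
  qed
  ultimately obtain F where F: "finite F" "F \<subseteq> L ` {0<..}" "S \<subseteq> \<Union> F"
    using compactinD[OF assms] by metis
  obtain A where A: "finite A" "F = L ` A" using finite_subset_image[OF F(1,2)] by blast
  have "S \<subseteq> L (Max (insert 1 A))"
  proof
    fix x assume "x \<in> S"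
    then obtain a where a: "a \<in> A" "x \<in> L a" using F(3) A(2) by blast
    then have "a \<le> Max (insert 1 A)" using A(1) by simp
    then show "x \<in> L (Max (insert 1 A))" using a(2) L_mono' by blast
  qed
  moreover have "Max (insert 1 A) \<ge> 1" using A(1) by simp
  ultimately show ?thesis using that[of "Max (insert 1 A)"] by simp
qed

text \<open>Openness gives an inner ball and compactness an outer one. Conversely, a subgroup
  containing a ball is open and closed, so inside a compact ball it is compact.\<close>

lemma compact_open_subgroup_iff_lattice: "compact_open_subgroup T K \<longleftrightarrow> lattice K"
proof
  assume K: "compact_open_subgroup T K"
  then have "add_subgroup K" by (simp add: compact_open_subgroup_def add_subgroup_def)
  moreover obtain \<epsilon> where "\<epsilon> > 0" "K \<subseteq> L \<epsilon>"
    using K compact_subset_L[of K] by (auto simp: compact_open_subgroup_def)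
  moreover have "\<exists>\<delta>>0. L \<delta> \<subseteq> K"
    using K unfolding compact_open_subgroup_def openin_T_iff by (metis add_0 subsetI)
  ultimately show "lattice K" by (auto simp: lattice_def)
next
  assume "lattice K"
  then obtain \<delta> \<epsilon> where K: "add_subgroup K" "\<delta> > 0" "L \<delta> \<subseteq> K" "\<epsilon> > 0" "K \<subseteq> L \<epsilon>"
    by (auto simp: lattice_def)
  have "openin T K"
    unfolding openin_T_iff using K(2,3) add_subgroup_add[OF K(1)] by blast
  moreover have "compactin T K"
    by (rule closed_compactin[OF compactin_L[OF K(4)] K(5) closedin_subgroup[OF K(1,2,3)]])
  ultimately show "compact_open_subgroup T K"
    using K(1) by (simp add: compact_open_subgroup_def add_subgroup_def)
qed

text \<open>Finitely many cosets on which \<open>\<Phi>\<close> is constant cover a ball containing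
  the support, and the smallest of their radii works everywhere.\<close>

lemma schwartz_eq_step_functions: "schwartz T = step_functions"
proof (intro equalityI subsetI)
  fix \<Phi> :: "'x \<Rightarrow> 'r::idom"
  assume "\<Phi> \<in> schwartz T"
  then have lc: "\<And>x. \<exists>U. openin T U \<and> x \<in> U \<and> (\<forall>y\<in>U. \<Phi> y = \<Phi> x)"
    and cs: "compactin T (T closure_of {x. \<Phi> x \<noteq> 0})"
    by (auto simp: schwartz_def topspace_T)
  obtain \<epsilon> where e: "\<epsilon> > 0" "T closure_of {x. \<Phi> x \<noteq> 0} \<subseteq> L \<epsilon>"
    using compact_subset_L[OF cs] by blast
  have zero: "\<Phi> x = 0" if "x \<notin> L \<epsilon>" for x
    using that e(2) closure_of_subset[of "{x. \<Phi> x \<noteq> 0}" T] by (auto simp: topspace_T)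
  have "\<exists>\<delta>>0. \<forall>z\<in>L \<delta>. \<Phi> (x + z) = \<Phi> x" for x
    using lc[of x] unfolding openin_T_iff by metis
  then obtain d where d: "\<And>x. d x > 0" "\<And>x z. z \<in> L (d x) \<Longrightarrow> \<Phi> (x + z) = \<Phi> x" by metis
  define W where "W x = {y. y - x \<in> L (d x)}" for x
  have "L \<epsilon> \<subseteq> \<Union> (W ` L \<epsilon>)"
    using add_subgroup_zero[OF add_subgroup_L[OF d(1)]] by (auto simp: W_def)
  moreover have "\<And>U. U \<in> W ` L \<epsilon> \<Longrightarrow> openin T U" using openin_coset[OF d(1)] by (auto simp: W_def)
  ultimately obtain F where F: "finite F" "F \<subseteq> W ` L \<epsilon>" "L \<epsilon> \<subseteq> \<Union> F"
    using compactinD[OF compactin_L[OF e(1)]] by metis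
  obtain A where A: "finite A" "F = W ` A" using finite_subset_image[OF F(1,2)] by blast
  \<comment> \<open>Keeping \<open>\<delta>\<close> below \<open>\<epsilon>\<close> makes
    translation by \<open>z\<close> preserve the complement of \<open>L \<epsilon>\<close>, where
    \<open>\<Phi>\<close> vanishes.\<close>
  define \<delta> where "\<delta> = Min (insert \<epsilon> (d ` A))"
  have \<delta>: "\<delta> > 0" "\<delta> \<le> \<epsilon>" "\<And>a. a \<in> A \<Longrightarrow> \<delta> \<le> d a"
    using A(1) e(1) d(1) by (auto simp: \<delta>_def)
  show "\<Phi> \<in> step_functions"
  proof (rule step_functionsI[OF e(1) zero \<delta>(1)])
    fix x z assume z: "z \<in> L \<delta>"
    show "\<Phi> (x + z) = \<Phi> x"
    proof (cases "x \<in> L \<epsilon>")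
      case True
      then obtain a where a: "a \<in> A" "x - a \<in> L (d a)" using F(3) A(2) by (auto simp: W_def)
      have "z \<in> L (d a)" using z L_mono'[OF \<delta>(3)[OF a(1)]] by blast
      then have "x - a + z \<in> L (d a)" by (rule add_subgroup_add[OF add_subgroup_L[OF d(1)] a(2)])
      then show ?thesis using d(2)[OF a(2)] d(2)[of "x - a + z" a] by (simp add: algebra_simps)
    next
      case False
      have "z \<in> L \<epsilon>" using z L_mono'[OF \<delta>(2)] by blast
      then show ?thesis
        using False zero add_subgroup_add_iff[OF add_subgroup_L[OF e(1)], of z x] by simp
    qed
  qed
next
  fix \<Phi> :: "'x \<Rightarrow> 'r::idom"
  assume "\<Phi> \<in> step_functions"
  then obtain \<epsilon> \<delta> where *: "\<epsilon> > 0" "\<And>x. x \<notin> L \<epsilon> \<Longrightarrow> \<Phi> x = 0"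
    "\<delta> > 0" "\<And>x z. z \<in> L \<delta> \<Longrightarrow> \<Phi> (x + z) = \<Phi> x"
    using step_functionsE by metis
  have "\<exists>U. openin T U \<and> x \<in> U \<and> (\<forall>y\<in>U. \<Phi> y = \<Phi> x)" for x
  proof (intro exI[of _ "{y. y - x \<in> L \<delta>}"] conjI ballI)
    show "x \<in> {y. y - x \<in> L \<delta>}" using add_subgroup_zero[OF add_subgroup_L[OF *(3)]] by simp
    show "\<Phi> y = \<Phi> x" if "y \<in> {y. y - x \<in> L \<delta>}" for y
      using that *(4)[of "y - x" x] by simp
  qed (rule openin_coset[OF *(3)])
  moreover have "compactin T (T closure_of {x. \<Phi> x \<noteq> 0})"
  proof (rule closed_compactin[OF compactin_L[OF *(1)]])
    show "T closure_of {x. \<Phi> x \<noteq> 0} \<subseteq> L \<epsilon>"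
      by (rule closure_of_minimal) (use *(2) closedin_subgroup[OF add_subgroup_L[OF *(1)] *(1)] in auto)
  qed simp
  ultimately show "\<Phi> \<in> schwartz T" by (simp add: schwartz_def topspace_T)
qed

lemma haar_functional:
  assumes "haar_measure T \<mu>"
  shows "haar_functional L \<mu>"
  by unfold_locales
    (use assms in \<open>simp_all add: haar_measure_def schwartz_eq_step_functions topspace_T\<close>)

text \<open>Multiplication by a small non-zero scalar; this provides the contraction required by
  \<open>vol_unit\<close>.\<close>

lemma contraction:
  assumes "\<epsilon> > 0" "\<delta> > 0"
  shows "\<exists>\<sigma>. inj \<sigma> \<and> (\<forall>x y. \<sigma> (x - y) = \<sigma> x - \<sigma> y) \<and>
       \<sigma> ` L \<epsilon> \<subseteq> L \<delta> \<and> (\<forall>\<eta>>0. \<exists>\<eta>'>0. L \<eta>' \<subseteq> \<sigma> ` L \<eta>)"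
proof -
  obtain t where t: "t \<noteq> 0" "v t < \<delta> / \<epsilon>" using exists_small[of "\<delta> / \<epsilon>"] assms by auto
  have "inj (smul t)" using t(1) by (intro injI) simp
  moreover have "\<forall>x y. smul t (x - y) = smul t x - smul t y" by (simp add: scale_right_diff_distrib)
  moreover have "smul t ` L \<epsilon> \<subseteq> L \<delta>"
  proof
    fix y assume "y \<in> smul t ` L \<epsilon>"
    then obtain x where x: "x \<in> L \<epsilon>" "y = smul t x" by blast
    have "v t * v (coord b x) \<le> \<delta> / \<epsilon> * \<epsilon>" if "b \<in> Basis" for b
      using t(2) x(1) that assms v_nonneg by (intro mult_mono) (auto simp: L_def)
    then show "y \<in> L \<delta>" using assms(1) x(2) by (simp add: L_def coord_scale v_mult)
  qed
  moreover have "\<exists>\<eta>'>0. L \<eta>' \<subseteq> smul t ` L \<eta>" if "\<eta> > 0" for \<eta>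
  proof (intro exI[of _ "v t * \<eta>"] conjI subsetI)
    show "v t * \<eta> > 0" using v_pos[OF t(1)] that by simp
    fix y assume y: "y \<in> L (v t * \<eta>)"
    have "inverse (v t) * v (coord b y) \<le> \<eta>" if "b \<in> Basis" for b
      using y that v_pos[OF t(1)] by (simp add: L_def field_simps)
    then have "smul (inverse t) y \<in> L \<eta>" by (simp add: L_def coord_scale v_mult v_inverse)
    moreover have "y = smul t (smul (inverse t) y)" using t(1) by simp
    ultimately show "y \<in> smul t ` L \<eta>" by (rule rev_image_eqI)
  qed
  ultimately show ?thesis by blast
qed

end

section \<open>Quadratic forms\<close>

lemma unit_inv_eq: "u * w = 1 \<Longrightarrow> unit_inv u = (w :: 'r::idom)"
  unfolding unit_inv_def by (rule the_equality) (auto intro: mult_left_cancel[THEN iffD1, of u])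

lemma unit_inv_mult: "u dvd 1 \<Longrightarrow> u * unit_inv u = (1 :: 'r::idom)"
  by (metis dvdE unit_inv_eq)

lemma unit_powi_minus:
  assumes "u dvd (1 :: 'r::idom)"
  shows "unit_powi u a * unit_powi u (- a) = 1"
  using unit_inv_mult[OF assms]
  by (cases "a = 0") (auto simp: unit_powi_def mult.commute simp flip: power_mult_distrib)

lemma unit_powi_square:
  assumes "u dvd (1 :: 'r::idom)"
  shows "unit_powi (u\<^sup>2) a = unit_powi u a * unit_powi u a"
proof -
  have "unit_inv (u\<^sup>2) = (unit_inv u)\<^sup>2"
    by (rule unit_inv_eq) (simp add: unit_inv_mult[OF assms] flip: power_mult_distrib)
  then show ?thesis by (simp add: unit_powi_def power2_eq_square power_mult_distrib)
qed

context nonarch_vector_space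
begin

context
  fixes f :: "'x \<Rightarrow> 'f"
  assumes f: "quadratic_form smul f" "nondegenerate smul f"
begin

lemma polar_sym: "polar f x y = polar f y x"
  by (simp add: polar_def add.commute)

lemma polar_in_dual: "polar f x \<in> dual smul"
  using f(1) by (simp add: quadratic_form_def dual_def)

lemma polar_add_left: "polar f (x + y) z = polar f x z + polar f y z"
  using dual_add[OF polar_in_dual[of z], of x y] by (simp add: polar_sym[of _ z])

lemma quadratic_form_minus: "f (- x) = f x"
proof -
  have "f (smul (- 1) x) = (- 1)\<^sup>2 * f x" using f(1) unfolding quadratic_form_def by blast
  then show ?thesis by simp
qed

lemma quadratic_form_zero: "f 0 = 0"
proof -
  have "f (smul 0 0) = 0\<^sup>2 * f 0" using f(1) unfolding quadratic_form_def by blast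
  then show ?thesis by simp
qed

lemma polar_bound:
  obtains M where "M > 0"
    "\<And>\<epsilon> \<delta> x z. \<epsilon> > 0 \<Longrightarrow> \<delta> > 0 \<Longrightarrow> x \<in> L \<epsilon> \<Longrightarrow> z \<in> L \<delta> \<Longrightarrow> v (polar f x z) \<le> \<epsilon> * (\<delta> * M)"
proof -
  have "\<exists>m>0. \<forall>\<delta> z. \<delta> > 0 \<longrightarrow> z \<in> L \<delta> \<longrightarrow> v (polar f b z) \<le> \<delta> * m" for b
    using dual_bound[OF polar_in_dual[of b]] by metis
  then obtain m where m: "\<And>b. m b > 0" "\<And>b \<delta> z. \<delta> > 0 \<Longrightarrow> z \<in> L \<delta> \<Longrightarrow> v (polar f b z) \<le> \<delta> * m b"
    by metis
  define M where "M = 1 + sum m Basis"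
  have "sum m Basis \<ge> 0" by (rule sum_nonneg) (use m(1) in \<open>auto intro: less_imp_le\<close>)
  then have M: "M > 0" by (simp add: M_def)
  have mM: "m b \<le> M" if "b \<in> Basis" for b
    using member_le_sum[OF that, of m] m(1) finite_Basis by (simp add: M_def less_imp_le)
  have "v (polar f x z) \<le> \<epsilon> * (\<delta> * M)" if *: "\<epsilon> > 0" "\<delta> > 0" "x \<in> L \<epsilon>" "z \<in> L \<delta>" for \<epsilon> \<delta> x z
  proof -
    have "polar f x z = (\<Sum>b\<in>Basis. coord b x * polar f b z)"
      using dual_coord[OF polar_in_dual[of z], of x] by (simp add: polar_sym[of z])
    moreover have "v (\<Sum>b\<in>Basis. coord b x * polar f b z) \<le> \<epsilon> * (\<delta> * M)"
    proof (rule v_sum_le)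
      show "0 \<le> \<epsilon> * (\<delta> * M)" using * M by simp
      fix b assume b: "b \<in> Basis"
      have "v (polar f b z) \<le> \<delta> * M"
        using m(2)[OF *(2,4), of b] mult_left_mono[OF mM[OF b], of \<delta>] *(2) by linarith
      then show "v (coord b x * polar f b z) \<le> \<epsilon> * (\<delta> * M)"
        unfolding v_mult using b *(1,3) v_nonneg by (intro mult_mono) (auto simp: L_def)
    qed
    ultimately show ?thesis by simp
  qed
  then show ?thesis using that M by blast
qed

text \<open>Non-degeneracy makes the coordinates of \<open>x\<close> fixed linear combinations of the \<open>polar f x b\<close>.\<close>

lemma polar_inverse_bound:
  obtains M where "M > 0"
    "\<And>r x. r > 0 \<Longrightarrow> (\<And>b. b \<in> Basis \<Longrightarrow> v (polar f x b) \<le> r) \<Longrightarrow> x \<in> L (M * r)"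
proof -
  have "\<exists>y. polar f y = coord b" for b
    using f(2) coord_in_dual[of b] unfolding nondegenerate_def bij_betw_def by (metis rangeE)
  then obtain y where y: "\<And>b. polar f (y b) = coord b" by metis
  have "\<exists>m>0. y b \<in> L m" for b by (rule L_exhaust)
  then obtain m where m: "\<And>b. m b > 0" "\<And>b. y b \<in> L (m b)" by metis
  define M where "M = 1 + sum m Basis"
  have "sum m Basis \<ge> 0" by (rule sum_nonneg) (use m(1) in \<open>auto intro: less_imp_le\<close>)
  then have M: "M > 0" by (simp add: M_def)
  have mM: "m b \<le> M" if "b \<in> Basis" for b
    using member_le_sum[OF that, of m] m(1) finite_Basis by (simp add: M_def less_imp_le)
  have "x \<in> L (M * r)" if r: "r > 0" "\<And>b. b \<in> Basis \<Longrightarrow> v (polar f x b) \<le> r" for r x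
    unfolding L_def
  proof (rule CollectI, rule ballI)
    fix b assume b: "b \<in> Basis"
    have "coord b x = (\<Sum>c\<in>Basis. coord c (y b) * polar f x c)"
      using dual_coord[OF polar_in_dual[of x], of "y b"] y[of b] polar_sym[of x "y b"] by simp
    moreover have "v (\<Sum>c\<in>Basis. coord c (y b) * polar f x c) \<le> M * r"
    proof (rule v_sum_le)
      fix c assume c: "c \<in> Basis"
      have "v (coord c (y b)) \<le> M" using m(2)[of b] mM[OF b] c by (force simp: L_def)
      then show "v (coord c (y b) * polar f x c) \<le> M * r"
        unfolding v_mult using r c M v_nonneg by (intro mult_mono) auto
    qed (use M r in simp)
    ultimately show "v (coord b x) \<le> M * r" by simp
  qed
  then show ?thesis using that M by blast
qed

text \<open>Smoothness of \<open>chi\<close> makes \<open>B\<close> and \<open>\<phi>\<close>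
  trivial near 0; non-triviality of \<open>chi\<close> together with the bound on the inverse of
  \<open>\<rho>\<close> controls orthogonals.\<close>

lemma weil_setting_quadratic_form:
  fixes chi :: "'f \<Rightarrow> 'r::idom"
  assumes chi: "smooth_character chi" "\<exists>t. chi t \<noteq> 1" and \<mu>: "haar_measure T \<mu>"
    and V: "lattice V" "vol \<mu> V = 1"
  shows "weil_setting L \<mu> (\<lambda>x y. chi (polar f x y)) (\<lambda>x. chi (f x)) (\<lambda>x. chi (- f x))"
proof -
  interpret H: haar_functional L \<mu> by (rule haar_functional[OF \<mu>])
  have add: "chi (x + y) = chi x * chi y" and unit: "chi x dvd 1" for x y
    using chi(1) by (auto simp: smooth_character_def)
  have "chi 0 \<noteq> 0" using unit[of 0] by auto
  then have zero: "chi 0 = 1" using add[of 0 0] by simp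
  have opn: "open {x. chi x = 1}" using chi(1) by (simp add: smooth_character_def)
  then have "\<forall>x\<in>{x. chi x = 1}. \<exists>e>0. \<forall>y. v (y - x) < e \<longrightarrow> y \<in> {x. chi x = 1}"
    unfolding open_iff_v .
  from bspec[OF this, of 0] obtain e where e: "e > 0" "\<And>y. v y < e \<Longrightarrow> chi y = 1"
    using zero by auto
  obtain t where t: "chi t \<noteq> 1" using chi(2) by blast
  then have vt: "v t > 0" using zero by (intro v_pos) auto
  obtain M where M: "M > 0"
    "\<And>\<epsilon> \<delta> x z. \<epsilon> > 0 \<Longrightarrow> \<delta> > 0 \<Longrightarrow> x \<in> L \<epsilon> \<Longrightarrow> z \<in> L \<delta> \<Longrightarrow> v (polar f x z) \<le> \<epsilon> * (\<delta> * M)"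
    using polar_bound by metis
  obtain N where N: "N > 0"
    "\<And>r x. r > 0 \<Longrightarrow> (\<And>b. b \<in> Basis \<Longrightarrow> v (polar f x b) \<le> r) \<Longrightarrow> x \<in> L (N * r)"
    using polar_inverse_bound by metis
  have perp: "perp (\<lambda>x y. chi (polar f x y)) (L \<epsilon>) \<subseteq> L (N * (v t / \<epsilon>))" if \<epsilon>: "\<epsilon> > 0" for \<epsilon>
  proof
    fix x assume x: "x \<in> perp (\<lambda>x y. chi (polar f x y)) (L \<epsilon>)"
    show "x \<in> L (N * (v t / \<epsilon>))"
    proof (rule N(2))
      show "v t / \<epsilon> > 0" using vt \<epsilon> by simp
      fix b assume b: "b \<in> Basis"
      show "v (polar f x b) \<le> v t / \<epsilon>"
      proof (rule ccontr)
        assume "\<not> v (polar f x b) \<le> v t / \<epsilon>"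
        then have gt: "v (polar f x b) > v t / \<epsilon>" by simp
        then have pos: "v (polar f x b) > 0" using vt \<epsilon> by (meson divide_pos_pos less_trans)
        then have nz: "polar f x b \<noteq> 0" using v_zero by auto
        \<comment> \<open>\<open>c\<close> rescales \<open>b\<close> so that its pairing with
          \<open>x\<close> is \<open>t\<close>, where \<open>chi\<close> is not 1. A pairing above
          \<open>v t / \<epsilon>\<close> would leave the rescaled vector in
          \<open>L \<epsilon>\<close>, against orthogonality.\<close>
        define c where "c = t * inverse (polar f x b)"
        have "v c \<le> \<epsilon>" using gt pos \<epsilon> unfolding c_def v_mult v_inverse by (simp add: field_simps)
        then have "smul c b \<in> L \<epsilon>"
          unfolding L_def using \<epsilon> b by (simp add: coord_scale coord_basis v_zero)
        then have "chi (polar f x (smul c b)) = 1" using x by (simp add: perp_def)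
        moreover have "polar f x (smul c b) = t"
          using nz by (simp add: dual_scale[OF polar_in_dual] c_def)
        ultimately show False using t by simp
      qed
    qed
  qed
  show ?thesis
  proof
    show "chi (polar f (x + y) z) = chi (polar f x z) * chi (polar f y z)" for x y z
      by (simp add: polar_add_left add)
    show "chi (polar f x y) = chi (polar f y x)" for x y by (simp add: polar_sym)
    show "chi (polar f 0 y) = 1" for y
      using dual_zero[OF polar_in_dual[of y]] by (simp add: polar_sym[of 0] zero)
    show "chi (f (x + y)) = chi (f x) * chi (f y) * chi (polar f x y)" for x y
      by (simp add: polar_def flip: add)
    show "chi (f (- x)) = chi (f x)" for x by (simp add: quadratic_form_minus)
    show "chi (f x) * chi (- f x) = 1" for x by (simp add: zero flip: add)
    show "\<exists>\<eta>>0. \<forall>x\<in>L \<eta>. chi (f x) = 1"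
    proof -
      have "openin T {x \<in> topspace T. f x \<in> {x. chi x = 1}}"
        using f(1) opn unfolding quadratic_form_def
        by (intro openin_continuous_map_preimage) (auto simp flip: open_openin)
      moreover have "0 \<in> {x \<in> topspace T. f x \<in> {x. chi x = 1}}"
        by (simp add: topspace_T quadratic_form_zero zero)
      ultimately show ?thesis unfolding openin_T_iff by fastforce
    qed
    show "\<exists>\<delta>>0. \<forall>x\<in>L \<epsilon>. \<forall>z\<in>L \<delta>. chi (polar f x z) = 1" if \<epsilon>: "\<epsilon> > 0" for \<epsilon>
    proof (intro exI[of _ "e / 2 / (\<epsilon> * M)"] conjI ballI)
      show \<delta>: "e / 2 / (\<epsilon> * M) > 0" using e(1) \<epsilon> M(1) by simp
      fix x z assume "x \<in> L \<epsilon>" "z \<in> L (e / 2 / (\<epsilon> * M))"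
      then have "v (polar f x z) \<le> \<epsilon> * (e / 2 / (\<epsilon> * M) * M)" by (rule M(2)[OF \<epsilon> \<delta>])
      also have "\<dots> = e / 2" using \<epsilon> M(1) by simp
      finally show "chi (polar f x z) = 1" using e(1) by (intro e(2)) simp
    qed
    show "\<exists>\<epsilon>>0. perp (\<lambda>x y. chi (polar f x y)) (L \<delta>) \<subseteq> L \<epsilon>" if \<delta>: "\<delta> > 0" for \<delta>
      using perp[OF \<delta>] N(1) vt \<delta> by (intro exI[of _ "N * (v t / \<delta>)"]) simp
    show "\<exists>\<epsilon>>0. perp (\<lambda>x y. chi (polar f x y)) (L \<epsilon>) \<subseteq> L \<delta>" if \<delta>: "\<delta> > 0" for \<delta>
    proof (intro exI[of _ "N * v t / \<delta>"] conjI)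
      show pos: "N * v t / \<delta> > 0" using N(1) vt \<delta> by simp
      \<comment> \<open>The orthogonal of the ball of radius s has radius at most N v(t) / s; the
        witness s makes this bound equal to \<open>\<delta>\<close>.\<close>
      have "N * (v t / (N * v t / \<delta>)) = \<delta>" using N(1) vt \<delta> by simp
      then show "perp (\<lambda>x y. chi (polar f x y)) (L (N * v t / \<delta>)) \<subseteq> L \<delta>"
        using perp[OF pos] by simp
    qed
    show "vol \<mu> K dvd 1" if "lattice K" for K
      by (rule H.vol_unit[OF V that contraction])
  qed
qed

end

end

text \<open>For fixed \<open>K\<close> the integral in the third part is the transform of a
  compactly supported function, so for non-zero X it vanishes at all large \<open>l\<close>, while
  the right-hand side is a unit. No \<open>K0\<close> can serve every \<open>l\<close>; hence
  \<open>K0\<close> is chosen after \<open>l\<close>, and the uniform version asks that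
  \<open>inv \<rho> l\<close> lie in \<open>K\<close>.\<close>

theorem proposition3p3:
  fixes v :: "'f::{field,topological_space} \<Rightarrow> real"
    and p q :: nat
    and r :: "'r::idom"
    and chi :: "'f \<Rightarrow> 'r"
    and smul :: "'f \<Rightarrow> 'x::ab_group_add \<Rightarrow> 'x"
    and dx :: "('x \<Rightarrow> 'r) \<Rightarrow> 'r"
    and dx' :: "(('x \<Rightarrow> 'f) \<Rightarrow> 'r) \<Rightarrow> 'r"
    and f :: "'x \<Rightarrow> 'f"
    and \<phi> :: "'x \<Rightarrow> 'r"
    and \<rho> :: "'x \<Rightarrow> 'x \<Rightarrow> 'f"
    and a :: int
    and s s' :: "('x \<Rightarrow> 'r) \<Rightarrow> 'x \<Rightarrow> 'r"
    and \<gamma> mod_\<rho> :: 'r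
  assumes F: "nonarch_local_field v" "CHAR('f) \<noteq> 2"
    and p: "p = residue_char v"
    and q: "q = card (residue_field v)"
    and R: "(of_nat p :: 'r) dvd 1" "r\<^sup>2 = of_nat q"
    and chi_char: "smooth_character chi" "\<exists>t. chi t \<noteq> 1"
    and X: "vector_space smul" "\<exists>B. finite_dimensional_vector_space smul B"
    and dx: "haar_measure (space_top smul) dx"
    and dx': "dual_measure smul chi dx dx'"
    and f: "quadratic_form smul f" "nondegenerate smul f"
    and \<rho>: "\<rho> = polar f"
    and mod_\<rho>: "mod_\<rho> = iso_module (space_top smul) dx (dual_top smul) dx' \<rho>"
    and a: "mod_\<rho> = unit_powi (of_nat q) a"
    and \<phi>: "\<phi> = (\<lambda>x. chi (f x))"
    and s: "s = weil_s smul chi dx r a f"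
    and s': "s' = weil_s' smul chi dx r a f"
    and \<gamma>: "\<gamma> = weil_factor smul chi dx r a f"
  shows
    "(\<forall>\<Phi>\<in>schwartz (space_top smul). \<forall>x.
        s \<Phi> x = mod_\<rho> * fourier smul chi dx (convolution dx \<Phi> \<phi>) (\<rho> x) \<and>
        s' \<Phi> x = unit_powi r a * fourier smul chi dx \<Phi> (\<rho> x) * unit_inv (\<phi> x))
     \<and>
     (\<forall>\<Phi>\<in>schwartz (space_top smul). \<forall>l\<in>dual smul.
        fourier smul chi dx (convolution dx \<Phi> \<phi>) l =
          \<gamma> * unit_powi r (- a) * fourier smul chi dx \<Phi> l * unit_inv (\<phi> (inv \<rho> l)))
     \<and>
     ((\<forall>l\<in>dual smul. \<exists>K0. compact_open_subgroup (space_top smul) K0 \<and>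
         (\<forall>K K'. compact_open_subgroup (space_top smul) K \<and> K0 \<subseteq> K \<and>
                 compact_open_subgroup (space_top smul) K' \<and> K0 \<subseteq> K' \<longrightarrow>
            integral_over dx K (\<lambda>x. \<phi> x * chi (l x)) = integral_over dx K' (\<lambda>x. \<phi> x * chi (l x))) \<and>
         (\<forall>K. compact_open_subgroup (space_top smul) K \<and> K0 \<subseteq> K \<longrightarrow>
            integral_over dx K (\<lambda>x. \<phi> x * chi (l x)) =
              \<gamma> * unit_powi r (- a) * unit_inv (\<phi> (inv \<rho> l))))
      \<and>
      (\<exists>K0. compact_open_subgroup (space_top smul) K0 \<and>
         (\<forall>K. compact_open_subgroup (space_top smul) K \<and> K0 \<subseteq> K \<longrightarrow>
            (\<forall>l\<in>dual smul. inv \<rho> l \<in> K \<longrightarrow>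
               integral_over dx K (\<lambda>x. \<phi> x * chi (l x)) =
                 \<gamma> * unit_powi r (- a) * unit_inv (\<phi> (inv \<rho> l))))))
     \<and>
     (\<exists>K0. compact_open_subgroup (space_top smul) K0 \<and>
        (\<forall>K. compact_open_subgroup (space_top smul) K \<and> K0 \<subseteq> K \<longrightarrow>
           \<gamma> = unit_powi r a * integral_over dx K (\<lambda>x. chi (f x))))"
proof -
  obtain Basis where "finite_dimensional_vector_space smul Basis" using X(2) by blast
  then interpret nonarch_vector_space v smul Basis
    by (intro nonarch_vector_space.intro F(1))
  \<comment> \<open>The dual measure provides the subgroup of volume 1 from which all volumes are
    shown to be units.\<close>
  obtain K1 where K1: "lattice K1" "vol dx K1 = 1"
    using dx' by (auto simp: dual_measure_def compact_open_subgroup_iff_lattice)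
  interpret W: weil_setting L dx "\<lambda>x y. chi (polar f x y)" "\<lambda>x. chi (f x)" "\<lambda>x. chi (- f x)"
    by (rule weil_setting_quadratic_form[OF f chi_char dx K1])
  have "r * r dvd 1"
    using card_residue_field_unit R by (simp add: p q power2_eq_square)
  then have r1: "r dvd 1" by (rule dvd_mult_left)
  define R where "R = unit_powi r a"
  define R' where "R' = unit_powi r (- a)"
  have RR': "R * R' = 1" unfolding R_def R'_def by (rule unit_powi_minus[OF r1])
  have mod: "mod_\<rho> = R * R" unfolding a R(2)[symmetric] R_def by (rule unit_powi_square[OF r1])
  have phi_unit_inv: "unit_inv (\<phi> x) = chi (- f x)" for x
    unfolding \<phi> by (rule unit_inv_eq[OF W.phi_inv])
  have bij: "bij_betw \<rho> UNIV (dual smul)" using f(2) by (simp add: nondegenerate_def \<rho>)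
  have \<rho>_dual: "\<rho> x \<in> dual smul" for x using bij by (auto simp: bij_betw_def)
  have inv_\<rho>: "inv \<rho> (\<rho> x) = x" for x using bij by (simp add: bij_betw_def)
  have \<rho>_inv: "\<rho> (inv \<rho> l) = l" if "l \<in> dual smul" for l
    using bij that by (simp add: bij_betw_def f_inv_into_f)
  have inj_inv: "inj_on (inv \<rho>) (dual smul)" using \<rho>_inv by (rule inj_on_inverseI)
  have fourier_\<rho>: "fourier smul chi dx \<Phi> (\<rho> x) = W.transform \<Phi> x" for \<Phi> x
    using \<rho>_dual by (simp add: fourier_def W.transform_def \<rho>)
  have d0'_1: "d0' smul chi dx r (- a) (inv \<rho>) \<Phi> x = R * W.transform \<Phi> x" for \<Phi> x
  proof -
    \<comment> \<open>Composition with the inverse of \<open>inv \<rho>\<close> is composition with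
      \<open>\<rho>\<close>, and the index \<open>- a\<close> turns the scalar of \<open>d0'\<close>
      into the a-th power of \<open>r\<close>.\<close>
    have "inv_into (dual smul) (inv \<rho>) x = \<rho> x"
      using inv_into_f_eq[OF inj_inv \<rho>_dual[of x]] inv_\<rho>[of x] by simp
    then show ?thesis by (simp add: d0'_def fourier_\<rho> R_def)
  qed
  have d0'_2: "d0' smul chi dx r (- a) (\<lambda>l. - inv \<rho> l) \<Phi> x = R * W.transform \<Phi> (- x)" for \<Phi> x
  proof -
    have "inv_into (dual smul) (\<lambda>l. - inv \<rho> l) x = \<rho> (- x)"
    proof (rule inv_into_f_eq)
      show "inj_on (\<lambda>l. - inv \<rho> l) (dual smul)" using inj_inv by (simp add: inj_on_def)
      show "- inv \<rho> (\<rho> (- x)) = x" using inv_\<rho>[of "- x"] by simp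
    qed (rule \<rho>_dual)
    then show ?thesis by (simp add: d0'_def fourier_\<rho> R_def)
  qed
  have s_eq: "s \<Phi> x = mod_\<rho> * W.transform (convolution dx \<Phi> \<phi>) x"
    if \<Phi>: "\<Phi> \<in> step_functions" for \<Phi> x
  proof -
    \<comment> \<open>The three inner operators give the convolution times \<open>R\<close>. The
      outer \<open>d0'\<close> contributes a second \<open>R\<close>, and their product is the
      module of \<open>\<rho>\<close>.\<close>
    have "chi (f y) * (R * W.transform (t0 chi f \<Phi>) (- y)) = R * convolution dx \<Phi> \<phi> y" for y
      using W.convolution_eq[OF \<Phi>, of y] unfolding \<phi> by (simp add: t0_def[abs_def] ac_simps)
    then have "t0 chi f (d0' smul chi dx r (- a) (\<lambda>l. - inv \<rho> l) (t0 chi f \<Phi>)) =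
        (\<lambda>y. R * convolution dx \<Phi> \<phi> y)"
      unfolding t0_def[of chi f "d0' smul chi dx r (- a) (\<lambda>l. - inv \<rho> l) (t0 chi f \<Phi>)"]
      by (simp only: d0'_2)
    then have "s \<Phi> x = R * W.transform (\<lambda>y. R * convolution dx \<Phi> \<phi> y) x"
      by (simp add: s weil_s_def d0'_1 flip: \<rho>)
    also have "W.transform (\<lambda>y. R * convolution dx \<Phi> \<phi> y) x = R * W.transform (convolution dx \<Phi> \<phi>) x"
      unfolding W.transform_def mult.assoc \<phi>
      by (rule W.mu_scale[OF W.step_mult_B(1)[OF W.step_convolution[OF \<Phi>]]])
    finally show ?thesis by (simp add: mod mult.assoc)
  qed
  have s'_eq: "s' \<Phi> x = R * W.transform \<Phi> x * chi (- f x)" for \<Phi> x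
    by (simp add: s' weil_s'_def t0_def d0'_1[unfolded \<rho>] mult.commute)
  obtain K0 where K0: "lattice K0" "\<And>x. x \<in> perp (\<lambda>x y. chi (polar f x y)) K0 \<Longrightarrow> chi (f x) = 1"
    "\<And>K. lattice K \<Longrightarrow> K0 \<subseteq> K \<Longrightarrow>
      integral_over dx K (\<lambda>x. chi (f x)) = integral_over dx K0 (\<lambda>x. chi (f x))"
    using W.integral_phi_stable by metis
  define G where "G = integral_over dx K0 (\<lambda>x. chi (f x))"
  note stable = K0(1,2) K0(3)[folded G_def]
  have G_unit: "G dvd 1" by (rule W.weil_integral_unit[OF stable])
  have conv: "W.transform (convolution dx \<Phi> \<phi>) x = G * W.transform \<Phi> x * chi (- f x)"
    if "\<Phi> \<in> step_functions" for \<Phi> x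
    unfolding \<phi> by (rule W.transform_convolution[OF stable that])
  have \<gamma>_eq: "\<gamma> = R * G"
    unfolding \<gamma> weil_factor_def
  proof (rule the_equality)
    have "R dvd 1" using RR' by (metis dvdI)
    then show "R * G dvd 1 \<and> (\<forall>\<Phi>\<in>schwartz T.
        weil_s smul chi dx r a f \<Phi> = (\<lambda>x. R * G * weil_s' smul chi dx r a f \<Phi> x))"
      using mult_dvd_mono[OF _ G_unit, of R 1]
      unfolding s[symmetric] s'[symmetric] schwartz_eq_step_functions
      by (auto simp: s_eq s'_eq conv mod fun_eq_iff ac_simps)
  next
    fix g assume "g dvd 1 \<and> (\<forall>\<Phi>\<in>schwartz T.
        weil_s smul chi dx r a f \<Phi> = (\<lambda>x. g * weil_s' smul chi dx r a f \<Phi> x))"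
    then have g: "s \<Phi> x = g * s' \<Phi> x" if "\<Phi> \<in> step_functions" for \<Phi> x
      using that by (simp add: schwartz_eq_step_functions s s')
    \<comment> \<open>Uniqueness needs one point where \<open>s' \<Phi>\<close> is non-zero: the
      indicator of \<open>K1\<close> has transform \<open>vol dx K1\<close> = 1 at 0.\<close>
    define \<Phi> :: "'x \<Rightarrow> 'r" where "\<Phi> = (\<lambda>x. if x \<in> K1 then 1 else 0)"
    have \<Phi>: "\<Phi> \<in> step_functions" unfolding \<Phi>_def by (rule restrict_step[OF K1(1) unif_const])
    have "W.transform \<Phi> 0 = vol dx K1"
      by (simp add: W.transform_def \<Phi>_def vol_def integral_over_def W.B_zero)
    then have tr: "W.transform \<Phi> 0 = 1" by (simp add: K1(2))
    have "chi (- f 0) \<noteq> 0" using W.phi_inv[of 0] by auto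
    moreover have "R \<noteq> 0" using RR' by auto
    ultimately have nz: "s' \<Phi> 0 \<noteq> 0" by (simp add: s'_eq tr)
    have "g * s' \<Phi> 0 = R * G * s' \<Phi> 0"
      unfolding g[OF \<Phi>, symmetric] by (simp add: s_eq[OF \<Phi>] conv[OF \<Phi>] s'_eq mod ac_simps)
    then show "g = R * G" using nz by simp
  qed
  have G_eq: "G = \<gamma> * R'" using RR' by (simp add: \<gamma>_eq mult.commute mult.left_commute)
  have int: "integral_over dx K (\<lambda>x. \<phi> x * chi (l x)) = \<gamma> * R' * unit_inv (\<phi> (inv \<rho> l))"
    if "lattice K" "K0 \<subseteq> K" "l \<in> dual smul" "inv \<rho> l \<in> K" for K l
  proof -
    have "polar f (inv \<rho> l) = l" using \<rho>_inv[OF that(3)] by (simp add: \<rho>)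
    then show ?thesis
      using W.integral_phi_B[OF stable that(1,2,4)] by (simp add: phi_unit_inv[unfolded \<phi>] G_eq \<phi>)
  qed
  show ?thesis
    unfolding compact_open_subgroup_iff_lattice schwartz_eq_step_functions R_def[symmetric] R'_def[symmetric]
  proof (intro conjI ballI allI)
    fix \<Phi> :: "'x \<Rightarrow> 'r" and x assume \<Phi>: "\<Phi> \<in> step_functions"
    show "s \<Phi> x = mod_\<rho> * fourier smul chi dx (convolution dx \<Phi> \<phi>) (\<rho> x)"
      using s_eq[OF \<Phi>] by (simp add: fourier_\<rho>)
    show "s' \<Phi> x = R * fourier smul chi dx \<Phi> (\<rho> x) * unit_inv (\<phi> x)"
      using s'_eq by (simp add: fourier_\<rho> phi_unit_inv)
  next
    fix \<Phi> :: "'x \<Rightarrow> 'r" and l assume \<Phi>: "\<Phi> \<in> step_functions" and l: "l \<in> dual smul"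
    show "fourier smul chi dx (convolution dx \<Phi> \<phi>) l =
        \<gamma> * R' * fourier smul chi dx \<Phi> l * unit_inv (\<phi> (inv \<rho> l))"
      using conv[OF \<Phi>, of "inv \<rho> l"] fourier_\<rho>[of _ "inv \<rho> l"]
      by (simp add: \<rho>_inv[OF l] phi_unit_inv G_eq)
  next
    fix l assume l: "l \<in> dual smul"
    obtain \<epsilon> \<eta> where e: "\<epsilon> > 0" "K0 \<subseteq> L \<epsilon>" "\<eta> > 0" "inv \<rho> l \<in> L \<eta>"
      using K0(1) L_exhaust[of "inv \<rho> l"] by (auto simp: lattice_def)
    \<comment> \<open>Enlarging \<open>K0\<close> to contain \<open>inv \<rho> l\<close> makes the
      completed square available over every larger lattice.\<close>
    define K2 where "K2 = L (max \<epsilon> \<eta>)"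
    have K2: "lattice K2" "K0 \<subseteq> K2" "inv \<rho> l \<in> K2"
      unfolding K2_def using e L_subset_max[OF e(1,3)] by (auto intro!: lattice_L simp: less_max_iff_disj)
    show "\<exists>K0. lattice K0 \<and>
         (\<forall>K K'. lattice K \<and> K0 \<subseteq> K \<and> lattice K' \<and> K0 \<subseteq> K' \<longrightarrow>
            integral_over dx K (\<lambda>x. \<phi> x * chi (l x)) = integral_over dx K' (\<lambda>x. \<phi> x * chi (l x))) \<and>
         (\<forall>K. lattice K \<and> K0 \<subseteq> K \<longrightarrow>
            integral_over dx K (\<lambda>x. \<phi> x * chi (l x)) = \<gamma> * R' * unit_inv (\<phi> (inv \<rho> l)))"
    proof (intro exI[of _ K2] conjI allI impI)
      show *: "integral_over dx K (\<lambda>x. \<phi> x * chi (l x)) = \<gamma> * R' * unit_inv (\<phi> (inv \<rho> l))"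
        if "lattice K \<and> K2 \<subseteq> K" for K
        using int[OF _ _ l, of K] that K2 by blast
      show "integral_over dx K (\<lambda>x. \<phi> x * chi (l x)) = integral_over dx K' (\<lambda>x. \<phi> x * chi (l x))"
        if "lattice K \<and> K2 \<subseteq> K \<and> lattice K' \<and> K2 \<subseteq> K'" for K K'
        using *[of K] *[of K'] that by simp
    qed (rule K2(1))
  next
    show "\<exists>K0. lattice K0 \<and> (\<forall>K. lattice K \<and> K0 \<subseteq> K \<longrightarrow> (\<forall>l\<in>dual smul. inv \<rho> l \<in> K \<longrightarrow>
        integral_over dx K (\<lambda>x. \<phi> x * chi (l x)) = \<gamma> * R' * unit_inv (\<phi> (inv \<rho> l))))"
      using int K0(1) by blast
  next
    show "\<exists>K0. lattice K0 \<and> (\<forall>K. lattice K \<and> K0 \<subseteq> K \<longrightarrow>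
        \<gamma> = R * integral_over dx K (\<lambda>x. chi (f x)))"
      using stable(1,3) \<gamma>_eq by blast
  qed
qed

end
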